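(* Let $\alpha>-1$, let $\varphi:\mathbb{D}\to\mathbb{D}$ be holomorphic and let $h\in\mathcal{A}^2_\alpha(\mathbb{D})$. Let $\nu_{h,\varphi}$ be the measure on $\mathbb{D}$ defined by $$\nu_{h,\varphi}(E)=\int_{\varphi^{-1}(E)}|h(z)|^2(1-|z|^2)^\alpha\,dA(z).$$ Then the following conditions are equivalent: (i) the weighted composition operator $W_{h,\varphi}$ is bounded on $\mathcal{A}^2_\alpha(\mathbb{D})$; (ii) $\nu_{h,\varphi}$ is an $\mathcal{A}^2_\alpha$-Carleson measure, in the sense that the canonical embedding $J:\mathcal{A}^2_\alpha(\mathbb{D})\to L^2(\mathbb{D},d\nu_{h,\varphi})$ is bounded; (iii) $$\sup_{|w|<1}\left\|\frac{(1-|w|^2)^{1+\alpha/2}\,h}{(1-\overline{w}\varphi)^{\alpha+2}}\right\|_{\mathcal{A}^2_\alpha}<\infty.$$ Moreover, $W_{h,\varphi}$ is compact on $\mathcal{A}^2_\alpha(\mathbb{D})$ if and only if $\nu_{h,\varphi}$ is a vanishing $\mathcal{A}^2_\alpha$-Carleson measure, or, equivalently, if and only if $$\left\|\frac{(1-|w|^2)^{1+\alpha/2}\,h}{(1-\overline{w}\varphi)^{\alpha+2}}\right\|_{\mathcal{A}^2_\alpha}\to 0\quad\text{as } |w|\to 1.$$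
   Context: $\mathbb{D}$ is the open unit disc in $\mathbb{C}$ and $dA$ is area measure. For $\alpha>-1$, the weighted Bergman space $\mathcal{A}^2_\alpha(\mathbb{D})$ is the Hilbert space of analytic $f$ on $\mathbb{D}$ with $\|f\|_{\mathcal{A}^2_\alpha}=\left(\frac1\pi\int_{\mathbb{D}}|f(z)|^2(1-|z|^2)^\alpha\,dA(z)\right)^{1/2}<\infty$. The weighted composition operator is $W_{h,\varphi}f(z)=h(z)f(\varphi(z))$. Here $E$ ranges over measurable subsets of $\mathbb{D}$. A measure is a vanishing $\mathcal{A}^2_\alpha$-Carleson measure if the canonical embedding of $\mathcal{A}^2_\alpha(\mathbb{D})$ into the corresponding $L^2$ space is compact. Powers of $1-\overline{w}\varphi$ are taken with the principal branch (its values have positive real part). *)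

theory Defs
  imports "HOL-Complex_Analysis.Complex_Analysis"
begin

text \<open>Elements of the function spaces below are total functions on the complex plane; their values
  outside the open unit disc are irrelevant, as is their behaviour on null sets in the L2 case.
  Hence the norms are seminorms on total functions, and limits are understood up to
  elements of seminorm zero.\<close>

definition bergman_weight :: "real \<Rightarrow> complex \<Rightarrow> real" where
  "bergman_weight \<alpha> z = (1 - (cmod z)\<^sup>2) powr \<alpha>"

definition bergman_space :: "real \<Rightarrow> (complex \<Rightarrow> complex) set" where
  "bergman_space \<alpha> = {f. f holomorphic_on ball 0 1 \<and>
     set_integrable lborel (ball 0 1) (\<lambda>z. (cmod (f z))\<^sup>2 * bergman_weight \<alpha> z)}"

definition bergman_norm :: "real \<Rightarrow> (complex \<Rightarrow> complex) \<Rightarrow> real" where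
  "bergman_norm \<alpha> f =
     sqrt (1 / pi * (LINT z:ball 0 1|lborel. (cmod (f z))\<^sup>2 * bergman_weight \<alpha> z))"

definition L2_space :: "complex measure \<Rightarrow> (complex \<Rightarrow> complex) set" where
  "L2_space \<mu> = {f \<in> borel_measurable \<mu>. integrable \<mu> (\<lambda>z. (cmod (f z))\<^sup>2)}"

definition L2_norm :: "complex measure \<Rightarrow> (complex \<Rightarrow> complex) \<Rightarrow> real" where
  "L2_norm \<mu> f = sqrt (LINT z|\<mu>. (cmod (f z))\<^sup>2)"

definition linear_operator ::
  "(complex \<Rightarrow> complex) set \<Rightarrow> (complex \<Rightarrow> complex) set \<Rightarrow>
   ((complex \<Rightarrow> complex) \<Rightarrow> complex \<Rightarrow> complex) \<Rightarrow> bool" where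
  "linear_operator X Y T \<longleftrightarrow> T ` X \<subseteq> Y \<and>
     (\<forall>f\<in>X. \<forall>g\<in>X. T (\<lambda>z. f z + g z) = (\<lambda>z. T f z + T g z)) \<and>
     (\<forall>c. \<forall>f\<in>X. T (\<lambda>z. c * f z) = (\<lambda>z. c * T f z))"

definition bounded_operator ::
  "(complex \<Rightarrow> complex) set \<Rightarrow> ((complex \<Rightarrow> complex) \<Rightarrow> real) \<Rightarrow>
   (complex \<Rightarrow> complex) set \<Rightarrow> ((complex \<Rightarrow> complex) \<Rightarrow> real) \<Rightarrow>
   ((complex \<Rightarrow> complex) \<Rightarrow> complex \<Rightarrow> complex) \<Rightarrow> bool" where
  "bounded_operator X normX Y normY T \<longleftrightarrow> linear_operator X Y T \<and>
     (\<exists>C. \<forall>f\<in>X. normY (T f) \<le> C * normX f)"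

definition compact_operator ::
  "(complex \<Rightarrow> complex) set \<Rightarrow> ((complex \<Rightarrow> complex) \<Rightarrow> real) \<Rightarrow>
   (complex \<Rightarrow> complex) set \<Rightarrow> ((complex \<Rightarrow> complex) \<Rightarrow> real) \<Rightarrow>
   ((complex \<Rightarrow> complex) \<Rightarrow> complex \<Rightarrow> complex) \<Rightarrow> bool" where
  "compact_operator X normX Y normY T \<longleftrightarrow> linear_operator X Y T \<and>
     (\<forall>F :: nat \<Rightarrow> complex \<Rightarrow> complex.
        range F \<subseteq> X \<and> bdd_above (range (\<lambda>n. normX (F n))) \<longrightarrow>
        (\<exists>r g. strict_mono r \<and> g \<in> Y \<and>
           (\<lambda>n. normY (\<lambda>z. T (F (r n)) z - g z)) \<longlonglongrightarrow> 0))"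

text \<open>The canonical embedding into L2 is the identity on functions; that it maps the
  Bergman space into L2 is part of being a linear operator between the two.\<close>

definition bergman_Carleson :: "real \<Rightarrow> complex measure \<Rightarrow> bool" where
  "bergman_Carleson \<alpha> \<mu> \<longleftrightarrow>
     bounded_operator (bergman_space \<alpha>) (bergman_norm \<alpha>) (L2_space \<mu>) (L2_norm \<mu>) (\<lambda>f. f)"

definition vanishing_bergman_Carleson :: "real \<Rightarrow> complex measure \<Rightarrow> bool" where
  "vanishing_bergman_Carleson \<alpha> \<mu> \<longleftrightarrow>
     compact_operator (bergman_space \<alpha>) (bergman_norm \<alpha>) (L2_space \<mu>) (L2_norm \<mu>) (\<lambda>f. f)"

definition weighted_comp ::
  "(complex \<Rightarrow> complex) \<Rightarrow> (complex \<Rightarrow> complex) \<Rightarrow> (complex \<Rightarrow> complex) \<Rightarrow> complex \<Rightarrow> complex" where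
  "weighted_comp h \<phi> f = (\<lambda>z. h z * f (\<phi> z))"

definition pullback_measure ::
  "real \<Rightarrow> (complex \<Rightarrow> complex) \<Rightarrow> (complex \<Rightarrow> complex) \<Rightarrow> complex measure" where
  "pullback_measure \<alpha> h \<phi> =
     distr (density (restrict_space lborel (ball 0 1))
              (\<lambda>z. ennreal ((cmod (h z))\<^sup>2 * bergman_weight \<alpha> z)))
           (restrict_space borel (ball 0 1)) \<phi>"

lemma emeasure_pullback_measure:
  assumes "\<phi> holomorphic_on ball 0 1" "\<phi> ` ball 0 1 \<subseteq> ball 0 1" "h holomorphic_on ball 0 1"
    and E: "E \<in> sets borel" "E \<subseteq> ball 0 1"
  shows "emeasure (pullback_measure \<alpha> h \<phi>) E =
    (\<integral>\<^sup>+z\<in>{z \<in> ball 0 1. \<phi> z \<in> E}. ennreal ((cmod (h z))\<^sup>2 * bergman_weight \<alpha> z) \<partial>lborel)"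
proof -
  let ?D = "ball 0 1 :: complex set"
  let ?w = "\<lambda>z. ennreal ((cmod (h z))\<^sup>2 * bergman_weight \<alpha> z)"
  have phi: "\<phi> \<in> restrict_space lborel ?D \<rightarrow>\<^sub>M restrict_space borel ?D"
  proof (rule measurable_restrict_space2)
    show "\<phi> \<in> space (restrict_space lborel ?D) \<rightarrow> ?D"
      using assms(2) by (auto simp: space_restrict_space)
    have "\<phi> \<in> borel_measurable (restrict_space borel ?D)"
      using assms(1) by (intro borel_measurable_continuous_on_restrict holomorphic_on_imp_continuous_on)
    then show "\<phi> \<in> borel_measurable (restrict_space lborel ?D)"
      by (simp cong: measurable_cong_sets add: sets_restrict_space)
  qed
  have "h \<in> borel_measurable (restrict_space borel ?D)"
    using assms(3) by (intro borel_measurable_continuous_on_restrict holomorphic_on_imp_continuous_on)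
  then have [measurable]: "h \<in> borel_measurable (restrict_space lborel ?D)"
    by (simp cong: measurable_cong_sets add: sets_restrict_space)
  have [measurable]: "(\<lambda>z. z) \<in> borel_measurable (restrict_space lborel ?D)"
    by (intro measurable_restrict_space1) auto
  have w: "?w \<in> borel_measurable (restrict_space lborel ?D)"
    unfolding bergman_weight_def by measurable
  have E': "E \<in> sets (restrict_space borel ?D)"
    using E by (auto simp: sets_restrict_space)
  have pre: "\<phi> -` E \<inter> ?D \<in> sets (restrict_space lborel ?D)"
    using measurable_sets[OF phi E'] by (simp add: space_restrict_space)
  have "emeasure (pullback_measure \<alpha> h \<phi>) E =
      (\<integral>\<^sup>+z\<in>\<phi> -` E \<inter> ?D. ?w z \<partial>restrict_space lborel ?D)"
    unfolding pullback_measure_def using phi w E' pre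
    by (simp add: emeasure_distr emeasure_density space_restrict_space)
  also have "\<dots> = (\<integral>\<^sup>+z\<in>{z \<in> ?D. \<phi> z \<in> E}. ?w z \<partial>lborel)"
    by (subst nn_integral_restrict_space)
       (auto intro!: nn_integral_cong simp: indicator_def split: if_splits)
  finally show ?thesis .
qed

text \<open>The complex \<open>powr\<close> is the principal branch. For h in the Bergman space, w in the disc and
  \<open>\<phi>\<close> a self-map of the disc, the test function again belongs to the Bergman space, because
  the denominator is bounded away from 0; so its \<open>bergman_norm\<close> is a genuine norm.\<close>

definition test_function ::
  "real \<Rightarrow> (complex \<Rightarrow> complex) \<Rightarrow> (complex \<Rightarrow> complex) \<Rightarrow> complex \<Rightarrow> complex \<Rightarrow> complex" where
  "test_function \<alpha> h \<phi> w = (\<lambda>z. of_real ((1 - (cmod w)\<^sup>2) powr (1 + \<alpha> / 2)) * h z /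
      (1 - cnj w * \<phi> z) powr of_real (\<alpha> + 2))"

end

theory Submission
  imports Defs
begin

text \<open>The test functions are \<open>h (k_w \<circ> \<phi>)\<close> for the kernels
  \<open>k_w(z) = (1 - |w|^2)^(1 + \<alpha>/2) / (1 - cnj w z)^(\<alpha> + 2)\<close>. By the Moebius change of variables all \<open>k_w\<close> have the same
  norm, and they tend to 0 locally uniformly as \<open>|w| \<rightarrow> 1\<close>; this gives the necessity of the
  conditions on the test functions. For sufficiency, the area mean value inequality on the disc of
  radius \<open>(1 - |z|) / 2\<close> around \<open>z\<close> yields
  \<open>|f(z)|^2 \<le> C \<integral> |f(u)|^2 |k_u(z)|^2 (1 - |u|^2)^\<alpha> dA(u)\<close>,
  and integrating against \<open>\<nu>\<close> with Tonelli bounds \<open>\<integral> |f|^2 d\<nu>\<close> by the integral of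
  \<open>|f(u)|^2 (1 - |u|^2)^\<alpha>\<close> times the squared norm of the test function at \<open>u\<close>. For compactness this is
  combined with normal families: a bounded sequence has a locally uniformly convergent subsequence
  with limit in the space.\<close>

subsection \<open>Holomorphic change of variables for area measure\<close>

text \<open>The kernel \<open>k_w\<close> is a constant multiple of the normalised reproducing
  kernel. Its power is the one for which \<open>|k_w(z)|^2 (1-|z|^2)^\<alpha>\<close> is the
  pullback of the weighted area under the disc automorphism that moves \<open>w\<close> to 0, so
  equality of the norms needs no explicit integral. Everything is expressed through the single
  function \<open>K(u)\<close>, the \<nu>-integral of \<open>|k_u|^2\<close>, which is \<pi> times
  the squared norm of the test function at \<open>u\<close>. The embedding and the weighted
  composition operator are each shown to be bounded iff \<open>K\<close> is bounded, and compact iff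
  \<open>K\<close> tends to 0 at the circle. That \<open>h\<close> lies in the space means exactly
  that \<nu> is finite. This justifies Tonelli and bounds \<open>K\<close> on every smaller disc, so
  only the behaviour of \<open>K\<close> near the circle matters. Two features of the setting shape
  the arguments: squared norms are kept as integrals with values in [0, \<infinity>], so that
  membership in a space becomes a conclusion; and limits are determined only up to null functions,
  so the limit in the compactness argument is identified by pointwise convergence and Fatou rather
  than by weak convergence.\<close>

definition complex_of_vec :: "real^2 \<Rightarrow> complex" where
  "complex_of_vec x = Complex (x $ 1) (x $ 2)"

definition vec_of_complex :: "complex \<Rightarrow> real^2" where
  "vec_of_complex z = vector [Re z, Im z]"

lemma complex_of_vec_of_complex [simp]: "complex_of_vec (vec_of_complex z) = z"
  by (simp add: complex_of_vec_def vec_of_complex_def)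

lemma vec_of_complex_of_vec [simp]: "vec_of_complex (complex_of_vec x) = x"
  by (simp add: complex_of_vec_def vec_of_complex_def vec_eq_iff forall_2)

lemma bounded_linear_complex_of_vec: "bounded_linear complex_of_vec"
  by (rule linear_conv_bounded_linear[THEN iffD1], rule linearI)
    (auto simp: complex_of_vec_def complex_eq_iff)

lemma bounded_linear_vec_of_complex: "bounded_linear vec_of_complex"
  by (rule linear_conv_bounded_linear[THEN iffD1], rule linearI)
    (auto simp: vec_of_complex_def vec_eq_iff forall_2)

lemma borel_measurable_complex_of_vec [measurable]: "complex_of_vec \<in> borel_measurable borel"
  by (intro borel_measurable_continuous_onI linear_continuous_on bounded_linear_complex_of_vec)

text \<open>The coordinate map takes boxes to boxes with the same side lengths, and Lebesgue measure
  is determined by its values on boxes.\<close>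

lemma lborel_distr_complex_of_vec: "distr lborel borel complex_of_vec = lborel"
proof (rule sym, rule lborel_eqI)
  fix l u :: complex assume le: "\<And>b. b \<in> Basis \<Longrightarrow> l \<bullet> b \<le> u \<bullet> b"
  have eq: "complex_of_vec -` box l u = box (vec_of_complex l) (vec_of_complex u)"
    by (auto simp: box_def complex_of_vec_def vec_of_complex_def Basis_complex_def Basis_vec_def inner_axis forall_2)
  have B: "(Basis :: (real^2) set) = {axis 1 1, axis 2 1}"
    by (auto simp: Basis_vec_def exhaust_2 UNIV_2)
  have ne: "axis (1::2) (1::real) \<noteq> axis 2 1" by (simp add: axis_eq_axis)
  have "emeasure (distr lborel borel complex_of_vec) (box l u) = emeasure lborel (box (vec_of_complex l) (vec_of_complex u))"
    by (simp add: emeasure_distr eq)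
  also have "\<dots> = (\<Prod>b\<in>Basis. (u - l) \<bullet> b)"
    using le[of 1] le[of \<i>] ne
    by (subst emeasure_lborel_box)
      (auto simp: B Basis_complex_def vec_of_complex_def inner_axis forall_2)
  finally show "emeasure (distr lborel borel complex_of_vec) (box l u) = (\<Prod>b\<in>Basis. (u - l) \<bullet> b)" .
qed simp

text \<open>In real coordinates the derivative of \<open>g\<close> is multiplication by
  \<open>g'(z)\<close>, whose determinant is \<open>|g'(z)|^2\<close>, so this is the substitution
  rule on \<open>real^2\<close>. The finiteness assumption supplies the absolute integrability on
  which that rule is based.\<close>

lemma nn_integral_change_of_variables_holomorphic:
  fixes f :: "complex \<Rightarrow> real"
  assumes S: "open S" and g: "g holomorphic_on S" and inj: "inj_on g S"
    and f: "f \<in> borel_measurable borel" and nn: "\<And>z. f z \<ge> 0"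
    and fin: "(\<integral>\<^sup>+z\<in>g ` S. ennreal (f z) \<partial>lborel) < \<infinity>"
  shows "(\<integral>\<^sup>+z\<in>S. ennreal ((cmod (deriv g z))\<^sup>2 * f (g z)) \<partial>lborel) = (\<integral>\<^sup>+z\<in>g ` S. ennreal (f z) \<partial>lborel)"
proof -
  define S' where "S' = complex_of_vec -` S"
  define g' where "g' x = (\<lambda>h. vec_of_complex (deriv g (complex_of_vec x) * complex_of_vec h))" for x
  define G where "G = (\<lambda>x. vec_of_complex (g (complex_of_vec x)))"
  have opS': "open S'"
    unfolding S'_def using S
    by (intro open_vimage) (auto intro: linear_continuous_on bounded_linear_complex_of_vec)
  have ogS: "open (g ` S)"
    by (rule open_mapping_thm3[OF g S inj])
  have GS: "G ` S' = complex_of_vec -` (g ` S)"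
  proof (rule set_eqI)
    fix x
    have "x \<in> G ` S' \<longleftrightarrow> (\<exists>y. complex_of_vec y \<in> S \<and> vec_of_complex (g (complex_of_vec y)) = x)" by (auto simp: S'_def G_def)
    also have "\<dots> \<longleftrightarrow> (\<exists>z\<in>S. vec_of_complex (g z) = x)" by (metis complex_of_vec_of_complex)
    also have "\<dots> \<longleftrightarrow> x \<in> complex_of_vec -` (g ` S)" by (auto simp: image_iff) (metis vec_of_complex_of_vec)
    finally show "x \<in> G ` S' \<longleftrightarrow> x \<in> complex_of_vec -` (g ` S)" .
  qed
  have opG: "open (G ` S')" unfolding GS using ogS
    by (intro open_vimage) (auto intro: linear_continuous_on bounded_linear_complex_of_vec)
  have der: "(G has_derivative g' x) (at x within S')" if "x \<in> S'" for x
  proof -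
    have "(g has_derivative (*) (deriv g (complex_of_vec x))) (at (complex_of_vec x))"
      using that g S by (simp add: S'_def has_field_derivative_def[symmetric] holomorphic_derivI)
    moreover have "(complex_of_vec has_derivative complex_of_vec) (at x within S')"
      by (rule bounded_linear_imp_has_derivative[OF bounded_linear_complex_of_vec])
    ultimately have "((\<lambda>x. g (complex_of_vec x)) has_derivative (\<lambda>h. deriv g (complex_of_vec x) * complex_of_vec h)) (at x within S')"
      using has_derivative_compose by fastforce
    then show ?thesis
      unfolding G_def g'_def by (rule bounded_linear.has_derivative[OF bounded_linear_vec_of_complex])
  qed
  have det: "\<bar>det (matrix (g' x))\<bar> = (cmod (deriv g (complex_of_vec x)))\<^sup>2" for x
    by (simp add: det_2 matrix_def g'_def vec_of_complex_def complex_of_vec_def axis_def cmod_def power2_eq_square)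
  have injG: "inj_on G S'"
    using inj unfolding inj_on_def G_def S'_def by (metis vec_of_complex_of_vec complex_of_vec_of_complex vimage_eq)
  have [measurable]: "f \<in> borel_measurable borel" by fact
  have [measurable]: "S' \<in> sets borel" "G ` S' \<in> sets borel" "S \<in> sets borel" "g ` S \<in> sets borel"
    using opG opS' S ogS by auto
  have mb: "(\<lambda>x. indicator (G ` S') x *\<^sub>R f (complex_of_vec x)) \<in> borel_measurable borel"
    by (intro borel_measurable_scaleR borel_measurable_indicator) measurable
  have 1: "(\<integral>\<^sup>+z\<in>g ` S. ennreal (f z) \<partial>lborel) = (\<integral>\<^sup>+x. ennreal (indicator (G ` S') x *\<^sub>R f (complex_of_vec x)) \<partial>lborel)"
    unfolding lborel_distr_complex_of_vec[symmetric] GS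
    by (subst nn_integral_distr)
      (auto intro!: nn_integral_cong simp: indicator_def lborel_distr_complex_of_vec)
  have "integrable lborel (\<lambda>x. indicator (G ` S') x *\<^sub>R f (complex_of_vec x))"
    using fin mb nn by (intro integrableI_nonneg) (auto simp: 1)
  then have abs1: "(\<lambda>x. f (complex_of_vec x)) absolutely_integrable_on (G ` S')"
    unfolding set_integrable_def using mb by (subst integrable_completion) auto
  \<comment> \<open>The substitution rule is about integrands with values in some
    \<open>real^n\<close>, so the scalar integrand is wrapped as a vector of length 1.\<close>
  define F :: "real^2 \<Rightarrow> real^1" where "F x = vec (f (complex_of_vec x))" for x
  have F: "F absolutely_integrable_on (G ` S')"
    by (rule absolutely_integrable_componentwise)
      (use abs1 in \<open>auto simp: F_def Basis_vec_def inner_axis\<close>)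
  have S'l: "S' \<in> sets lebesgue" by simp
  have abs2: "(\<lambda>x. \<bar>det (matrix (g' x))\<bar> *\<^sub>R F (G x)) absolutely_integrable_on S'"
    and int: "integral S' (\<lambda>x. \<bar>det (matrix (g' x))\<bar> *\<^sub>R F (G x)) = integral (G ` S') F"
    using has_absolute_integral_change_of_variables[OF S'l der injG, of F "integral (G ` S') F"] F
    by auto
  have i1: "integral (G ` S') F $ 1 = integral (G ` S') (\<lambda>x. f (complex_of_vec x))"
    using set_lebesgue_integral_eq_integral(1)[OF F] by (simp add: integral_component_eq_cart[symmetric] F_def)
  have i2: "integral S' (\<lambda>x. \<bar>det (matrix (g' x))\<bar> *\<^sub>R F (G x)) $ 1
      = integral S' (\<lambda>x. (cmod (deriv g (complex_of_vec x)))\<^sup>2 * f (g (complex_of_vec x)))"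
    using set_lebesgue_integral_eq_integral(1)[OF abs2]
    by (subst integral_component_eq_cart[symmetric]) (simp_all add: F_def det G_def)
  have abs3: "(\<lambda>x. (cmod (deriv g (complex_of_vec x)))\<^sup>2 * f (g (complex_of_vec x))) absolutely_integrable_on S'"
    using absolutely_integrable_component[OF abs2, of "axis 1 1"]
    by (simp add: F_def inner_axis det G_def)
  have nnl: "(\<integral>\<^sup>+x. ennreal (indicator A x *\<^sub>R h x) \<partial>lborel) = ennreal (integral A h)"
    if "h absolutely_integrable_on A" "\<And>x. h x \<ge> 0" for A and h :: "real^2 \<Rightarrow> real"
  proof -
    have "(\<integral>\<^sup>+x. ennreal (indicator A x *\<^sub>R h x) \<partial>lebesgue) = ennreal (LINT x:A|lebesgue. h x)"
      using that unfolding set_integrable_def set_lebesgue_integral_def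
      by (intro nn_integral_eq_integral) auto
    then show ?thesis
      using that by (simp add: nn_integral_completion set_lebesgue_integral_eq_integral)
  qed
  have gm: "(\<lambda>z. indicator S z *\<^sub>R g z) \<in> borel_measurable borel"
       "(\<lambda>z. indicator S z *\<^sub>R deriv g z) \<in> borel_measurable borel"
    using S g by (auto intro!: borel_measurable_continuous_on_indicator holomorphic_on_imp_continuous_on holomorphic_deriv)
  \<comment> \<open>Nothing is known about \<open>g\<close> outside \<open>S\<close>. Cutting off
    \<open>g\<close> and its derivative as well makes both Borel, and the outer indicator hides the
    change.\<close>
  have [measurable]: "(\<lambda>z. indicator S z * ((cmod (deriv g z))\<^sup>2 * f (g z))) \<in> borel_measurable borel"
  proof -
    have eq: "(\<lambda>z. indicator S z * ((cmod (deriv g z))\<^sup>2 * f (g z))) =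
      (\<lambda>z. indicator S z * ((cmod (indicator S z *\<^sub>R deriv g z))\<^sup>2 * f (indicator S z *\<^sub>R g z)))"
      by (auto simp: indicator_def)
    show ?thesis using gm unfolding eq by measurable
  qed
  have "(\<integral>\<^sup>+z\<in>S. ennreal ((cmod (deriv g z))\<^sup>2 * f (g z)) \<partial>lborel)
      = (\<integral>\<^sup>+z. ennreal (indicator S z * ((cmod (deriv g z))\<^sup>2 * f (g z))) \<partial>lborel)"
    by (intro nn_integral_cong) (auto simp: indicator_def)
  also have "\<dots> = (\<integral>\<^sup>+x. ennreal (indicator S' x *\<^sub>R ((cmod (deriv g (complex_of_vec x)))\<^sup>2 * f (g (complex_of_vec x)))) \<partial>lborel)"
    by (subst lborel_distr_complex_of_vec[symmetric], subst nn_integral_distr, measurable)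
      (auto intro!: nn_integral_cong simp: indicator_def S'_def)
  also have "\<dots> = ennreal (integral S' (\<lambda>x. (cmod (deriv g (complex_of_vec x)))\<^sup>2 * f (g (complex_of_vec x))))"
    using nn by (intro nnl abs3) auto
  also have "\<dots> = ennreal (integral (G ` S') (\<lambda>x. f (complex_of_vec x)))"
    using i1 i2 int by simp
  also have "\<dots> = (\<integral>\<^sup>+x. ennreal (indicator (G ` S') x *\<^sub>R f (complex_of_vec x)) \<partial>lborel)"
    using nn by (intro nnl[symmetric] abs1) auto
  finally show ?thesis unfolding 1 .
qed

subsection \<open>The weight and the kernels\<close>

lemma borel_measurable_bergman_weight [measurable]: "bergman_weight \<alpha> \<in> borel_measurable borel"
  unfolding bergman_weight_def by measurable

lemma bergman_weight_nonneg [simp]: "bergman_weight \<alpha> z \<ge> 0"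
  by (simp add: bergman_weight_def)

lemma emeasure_ball_complex: "r \<ge> 0 \<Longrightarrow> emeasure lborel (ball (c::complex) r) = ennreal (pi * r\<^sup>2)"
  by (simp add: emeasure_ball unit_ball_vol_2)

text \<open>For negative \<alpha> the weight blows up at the circle. Where \<open>1 - |z|^2\<close>
  is between \<open>2^-(k+1)\<close> and \<open>2^-k\<close> it is at most
  \<open>2^(-\<alpha>(k+1))\<close>, on a set of area at most \<open>\<pi> 2^-k\<close>; the
  resulting series is geometric with ratio \<open>2^-(1+\<alpha>)\<close>, which is below 1 because
  \<alpha> > -1.\<close>

lemma nn_integral_bergman_weight_finite:
  assumes "\<alpha> > -1"
  shows "(\<integral>\<^sup>+z\<in>ball 0 1. ennreal (bergman_weight \<alpha> z) \<partial>lborel) < \<infinity>"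
proof (cases "\<alpha> \<ge> 0")
  case True
  have "(\<integral>\<^sup>+z\<in>ball 0 1. ennreal (bergman_weight \<alpha> z) \<partial>lborel) \<le> (\<integral>\<^sup>+z\<in>ball 0 1. 1 \<partial>(lborel::complex measure))"
  proof (rule nn_integral_mono)
    fix z :: complex
    have "bergman_weight \<alpha> z \<le> 1" if "z \<in> ball 0 1"
      using True that powr_mono2[of \<alpha> "1 - (cmod z)\<^sup>2" 1] by (simp add: bergman_weight_def abs_square_le_1)
    then show "ennreal (bergman_weight \<alpha> z) * indicator (ball 0 1) z \<le> 1 * indicator (ball 0 1) z"
      by (auto simp: indicator_def)
  qed
  also have "\<dots> < \<infinity>" by (simp add: emeasure_ball_complex)
  finally show ?thesis .
next
  case False
  \<comment> \<open>The full outer rings \<open>1 - |z|^2 \<le> 2^-k\<close>, nested rather than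
    disjoint: their area is simple, and the overlap only enlarges the upper bound.\<close>
  define A :: "nat \<Rightarrow> complex set" where "A k = ball 0 1 - ball 0 (sqrt (1 - (1/2)^k))" for k
  define q where "q = (1/2) powr (1 + \<alpha>)"
  have q: "0 < q" "q < 1" using assms powr_less_mono'[of "1/2" 0 "1+\<alpha>"] by (simp_all add: q_def)
  have [measurable]: "A k \<in> sets borel" for k by (simp add: A_def)
  have emA: "emeasure lborel (A k) = ennreal (pi * (1/2)^k)" for k
  proof -
    have k: "(1/2::real)^k \<le> 1" by (simp add: power_le_one)
    then have sub: "ball 0 (sqrt (1 - (1/2)^k)) \<subseteq> ball (0::complex) 1"
      by (intro subset_ball) (auto simp: real_sqrt_le_1_iff)
    have "emeasure lborel (A k) = ennreal (pi * 1\<^sup>2) - ennreal (pi * (sqrt (1 - (1/2)^k))\<^sup>2)"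
      unfolding A_def using k sub
      by (subst emeasure_Diff) (auto simp: emeasure_ball_complex)
    also have "\<dots> = ennreal (pi * (1/2)^k)"
      using k by (subst ennreal_minus) (auto simp: algebra_simps)
    finally show ?thesis .
  qed
  have pt: "ennreal (bergman_weight \<alpha> z) * indicator (ball 0 1) z
      \<le> (\<Sum>k. ennreal ((1/2) powr (\<alpha> * (k + 1))) * indicator (A k) z)" for z
  proof (cases "z \<in> ball 0 1")
    case True
    define t where "t = 1 - (cmod z)\<^sup>2"
    have t: "0 < t" "t \<le> 1" using True by (auto simp: t_def abs_square_less_1)
    \<comment> \<open>The dyadic scale of \<open>t\<close>:
      \<open>2^-(k+1) \<le> t \<le> 2^-k\<close>.\<close>
    define k where "k = nat \<lfloor>log (1/2) t\<rfloor>"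
    have l0: "log (1/2) t \<ge> 0" using t by (simp add: log_def divide_nonpos_neg)
    have kl: "real k \<le> log (1/2) t" "log (1/2) t \<le> real (k + 1)"
      unfolding k_def using l0 by linarith+
    have teq: "t = (1/2) powr (log (1/2) t)" using t by simp
    have t1: "t \<le> (1/2)^k"
      using powr_mono'[OF kl(1), of "1/2"] teq by (simp add: powr_realpow)
    have t2: "(1/2) powr (k + 1) \<le> t"
      using powr_mono'[OF kl(2), of "1/2"] teq by (simp add: add.commute)
    have "sqrt (1 - (1/2)^k) \<le> cmod z"
      using t1 by (intro real_le_lsqrt) (auto simp: t_def power_le_one)
    then have "z \<in> A k" using True by (auto simp: A_def)
    have "bergman_weight \<alpha> z \<le> ((1/2) powr (k + 1)) powr \<alpha>"
      unfolding bergman_weight_def t_def[symmetric] using False t2 by (intro powr_mono2') auto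
    then have "ennreal (bergman_weight \<alpha> z) * indicator (ball 0 1) z
       \<le> ennreal ((1/2) powr (\<alpha> * (k + 1))) * indicator (A k) z"
      using True \<open>z \<in> A k\<close> by (auto simp: powr_powr mult.commute intro!: ennreal_leI)
    also have "\<dots> \<le> (\<Sum>k. ennreal ((1/2) powr (\<alpha> * (k + 1))) * indicator (A k) z)"
      using sum_le_suminf[of "\<lambda>k. ennreal ((1/2) powr (\<alpha> * (k + 1))) * indicator (A k) z" "{k}"]
      by (simp add: summableI del: sum_mult_indicator)
    finally show ?thesis .
  qed auto
  have "(\<integral>\<^sup>+z\<in>ball 0 1. ennreal (bergman_weight \<alpha> z) \<partial>lborel)
      \<le> (\<integral>\<^sup>+z. (\<Sum>k. ennreal ((1/2) powr (\<alpha> * (k + 1))) * indicator (A k) z) \<partial>lborel)"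
    by (intro nn_integral_mono pt)
  also have "\<dots> = (\<Sum>k. ennreal ((1/2) powr (\<alpha> * (k + 1))) * emeasure lborel (A k))"
    by (subst nn_integral_suminf) (auto simp: nn_integral_cmult)
  also have "\<dots> = (\<Sum>k. ennreal (pi * (1/2) powr \<alpha> * q ^ k))"
    unfolding emA q_def
    by (intro arg_cong[where f = suminf] ext)
      (simp add: ennreal_mult[symmetric] powr_realpow[symmetric] powr_powr powr_add[symmetric] algebra_simps)
  also have "\<dots> < \<infinity>"
    using q by (subst suminf_ennreal2) (auto intro!: summable_mult summable_geometric)
  finally show ?thesis .
qed

text \<open>Divided by \<open>|1 - cnj w z|^2\<close>, this computes \<open>1 - |m(z)|^2\<close> for
  the automorphism \<open>m(z) = (z - w) / (1 - cnj w z)\<close>.\<close>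

lemma Moebius_norm_identity:
  "(cmod (1 - cnj w * z))\<^sup>2 - (cmod (z - w))\<^sup>2 = (1 - (cmod w)\<^sup>2) * (1 - (cmod z)\<^sup>2)"
  by (simp only: cmod_power2) (simp add: power2_eq_square algebra_simps)

lemma one_minus_cnj_mult_nonzero:
  assumes "cmod w < 1" "cmod z \<le> 1" shows "1 - cnj w * z \<noteq> 0"
proof -
  have "cmod (cnj w * z) \<le> cmod w * 1" unfolding norm_mult using assms by (intro mult_mono) auto
  then show ?thesis using assms by auto
qed

lemma has_field_derivative_Moebius:
  assumes "cmod w < 1" "cmod z < 1"
  shows "(Moebius_function 0 w has_field_derivative (1 - (cmod w)\<^sup>2) / (1 - cnj w * z)\<^sup>2) (at z)"
proof -
  have nz: "1 - cnj w * z \<noteq> 0" using assms by (intro one_minus_cnj_mult_nonzero) auto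
  show ?thesis
    unfolding Moebius_function_simple[abs_def]
    by (rule derivative_eq_intros refl nz | simp)+
      (simp add: power2_eq_square algebra_simps flip: complex_norm_square[unfolded power2_eq_square of_real_mult])
qed

text \<open>The automorphism belonging to \<open>-w\<close> is a two-sided inverse on the
  disc.\<close>

lemma Moebius_function_image:
  assumes "cmod w < 1"
  shows "Moebius_function 0 w ` ball 0 1 = ball 0 1" "inj_on (Moebius_function 0 w) (ball 0 1)"
proof -
  have c1: "Moebius_function 0 w (Moebius_function 0 (-w) z) = z" if "cmod z < 1" for z
    using Moebius_function_compose[of w "-w" z] assms that by auto
  have c2: "Moebius_function 0 (-w) (Moebius_function 0 w z) = z" if "cmod z < 1" for z
    using Moebius_function_compose[of "-w" w z] assms that by auto
  show "inj_on (Moebius_function 0 w) (ball 0 1)"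
    by (rule inj_on_inverseI[where g = "Moebius_function 0 (-w)"]) (auto simp: c2)
  show "Moebius_function 0 w ` ball 0 1 = ball 0 1"
  proof safe
    fix z :: complex assume "z \<in> ball 0 1"
    then show "Moebius_function 0 w z \<in> ball 0 1"
      using Moebius_function_norm_lt_1[OF assms] by auto
  next
    fix z :: complex assume z: "z \<in> ball 0 1"
    then have "Moebius_function 0 (-w) z \<in> ball 0 1"
      using Moebius_function_norm_lt_1[of "-w"] assms by auto
    with c1 z show "z \<in> Moebius_function 0 w ` ball 0 1" by (metis image_eqI mem_ball_0)
  qed
qed

text \<open>Up to a constant factor, the reproducing kernel at \<open>w\<close> divided by its
  norm.\<close>

definition bergman_kernel :: "real \<Rightarrow> complex \<Rightarrow> complex \<Rightarrow> complex" where
  "bergman_kernel \<alpha> w z =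
     of_real ((1 - (cmod w)\<^sup>2) powr (1 + \<alpha> / 2)) / (1 - cnj w * z) powr of_real (\<alpha> + 2)"

text \<open>The squared modulus of the kernel, written with real powers only: joint measurability
  and monotonicity estimates are then direct, without the complex branch.\<close>

definition kernel_sq :: "real \<Rightarrow> complex \<Rightarrow> complex \<Rightarrow> real" where
  "kernel_sq \<alpha> w z = (1 - (cmod w)\<^sup>2) powr (2 + \<alpha>) / cmod (1 - cnj w * z) powr (2 * \<alpha> + 4)"

lemma cmod_bergman_kernel_sq:
  assumes "cmod w < 1"
  shows "(cmod (bergman_kernel \<alpha> w z))\<^sup>2 = kernel_sq \<alpha> w z"
proof -
  have [simp]: "(x powr a)\<^sup>2 = x powr (2 * a)" if "x \<ge> 0" for x a :: real
    using that by (simp add: power2_eq_square powr_add[symmetric])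
  have "complex_of_real (\<alpha> + 2) \<in> \<real>" by (rule Reals_of_real)
  then have "cmod ((1 - cnj w * z) powr of_real (\<alpha> + 2)) = cmod (1 - cnj w * z) powr (\<alpha> + 2)"
    by (subst norm_powr_real_powr') auto
  then show ?thesis
    using assms by (simp add: bergman_kernel_def kernel_sq_def norm_divide power_divide abs_square_le_1 algebra_simps)
qed

text \<open>On the disc \<open>1 - cnj w * z\<close> has positive real part and so avoids the cut of
  the principal branch.\<close>

lemma bergman_kernel_holomorphic:
  assumes "cmod w < 1"
  shows "bergman_kernel \<alpha> w holomorphic_on ball 0 1"
proof -
  have "1 - cnj w * z \<notin> \<real>\<^sub>\<le>\<^sub>0" if "cmod z < 1" for z
  proof -
    have "cmod (cnj w * z) \<le> cmod w * 1" unfolding norm_mult using that by (intro mult_mono) auto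
    then have "Re (1 - cnj w * z) > 0" using complex_Re_le_cmod[of "cnj w * z"] assms by (simp del: complex_cnj_mult)
    then show ?thesis by (auto simp: complex_nonpos_Reals_iff)
  qed
  moreover have "(1 - cnj w * z) powr of_real (\<alpha> + 2) \<noteq> 0" if "cmod z < 1" for z
    using one_minus_cnj_mult_nonzero[OF assms, of z] that by (simp add: powr_def)
  ultimately show ?thesis
    unfolding bergman_kernel_def[abs_def] by (intro holomorphic_intros) auto
qed

text \<open>Substitution by the automorphism \<open>m\<close> with \<open>m(w) = 0\<close>: the
  Jacobian times the transported weight is exactly the integrand on the left.\<close>

lemma nn_integral_bergman_kernel:
  assumes "\<alpha> > -1" "cmod w < 1"
  shows "(\<integral>\<^sup>+z\<in>ball 0 1. ennreal ((cmod (bergman_kernel \<alpha> w z))\<^sup>2 * bergman_weight \<alpha> z) \<partial>lborel)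
    = (\<integral>\<^sup>+z\<in>ball 0 1. ennreal (bergman_weight \<alpha> z) \<partial>lborel)"
proof -
  let ?m = "Moebius_function 0 w"
  have "(\<integral>\<^sup>+z\<in>ball 0 1. ennreal (bergman_weight \<alpha> z) \<partial>lborel) =
     (\<integral>\<^sup>+z\<in>?m ` ball 0 1. ennreal (bergman_weight \<alpha> z) \<partial>lborel)"
    by (simp add: Moebius_function_image assms)
  also have "\<dots> = (\<integral>\<^sup>+z\<in>ball 0 1. ennreal ((cmod (deriv ?m z))\<^sup>2 * bergman_weight \<alpha> (?m z)) \<partial>lborel)"
    using assms nn_integral_bergman_weight_finite
    by (intro nn_integral_change_of_variables_holomorphic[symmetric])
      (auto simp: Moebius_function_image Moebius_function_holomorphic)
  also have "\<dots> = (\<integral>\<^sup>+z\<in>ball 0 1. ennreal ((cmod (bergman_kernel \<alpha> w z))\<^sup>2 * bergman_weight \<alpha> z) \<partial>lborel)"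
  proof (rule nn_integral_cong)
    fix z :: complex
    have "(cmod (deriv ?m z))\<^sup>2 * bergman_weight \<alpha> (?m z) = (cmod (bergman_kernel \<alpha> w z))\<^sup>2 * bergman_weight \<alpha> z"
      if z: "cmod z < 1"
    proof -
      \<comment> \<open>With \<open>a\<close> and \<open>b\<close> below,
        \<open>|m'(z)| = a / d^2\<close> and \<open>1 - |m(z)|^2 = a b / d^2\<close>. Hence
        \<open>|m'|^2 (1 - |m|^2)^\<alpha> = a^(2+\<alpha>) b^\<alpha> / d^(2\<alpha>+4)\<close>,
        which is the squared kernel times the weight \<open>b^\<alpha>\<close>.\<close>
      define d where "d = cmod (1 - cnj w * z)"
      have d: "d > 0" using one_minus_cnj_mult_nonzero[of w z] assms z by (simp add: d_def)
      define a where "a = 1 - (cmod w)\<^sup>2"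
      define b where "b = 1 - (cmod z)\<^sup>2"
      have ab: "a > 0" "b > 0" using assms z by (auto simp: a_def b_def abs_square_less_1)
      have "deriv ?m z = of_real a / (1 - cnj w * z)\<^sup>2"
        using has_field_derivative_Moebius[OF assms(2) z] by (simp add: DERIV_imp_deriv a_def)
      then have 1: "cmod (deriv ?m z) = a / d\<^sup>2"
        using ab by (simp add: norm_divide norm_power d_def)
      have "1 - (cmod (?m z))\<^sup>2 = (d\<^sup>2 - (cmod (z - w))\<^sup>2) / d\<^sup>2"
        using d by (simp only: Moebius_function_simple norm_divide power_divide d_def) (simp add: field_simps)
      then have 2: "1 - (cmod (?m z))\<^sup>2 = a * b / d\<^sup>2"
        by (simp add: Moebius_norm_identity a_def b_def d_def)
      have d2: "d\<^sup>2 = d powr 2" "a\<^sup>2 = a powr 2" using d ab by (simp_all add: powr_numeral)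
      have d2a: "d powr (\<alpha> * 2) = d powr \<alpha> * d powr \<alpha>"
        using powr_add[of d \<alpha> \<alpha>] by (simp add: mult_2_right)
      show ?thesis
        unfolding bergman_weight_def 2 1 cmod_bergman_kernel_sq[OF assms(2)] kernel_sq_def
        unfolding a_def[symmetric] b_def[symmetric] d_def[symmetric] power_divide d2
        using d ab
        by (simp add: powr_divide powr_mult powr_add powr_powr d2[symmetric] d2a power2_eq_square
            power4_eq_xxxx field_simps)
    qed
    then show "ennreal ((cmod (deriv ?m z))\<^sup>2 * bergman_weight \<alpha> (?m z)) * indicator (ball 0 1) z
       = ennreal ((cmod (bergman_kernel \<alpha> w z))\<^sup>2 * bergman_weight \<alpha> z) * indicator (ball 0 1) z"
      by (auto simp: indicator_def)
  qed
  finally show ?thesis ..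
qed

subsection \<open>Area mean value inequality\<close>

text \<open>Cauchy's formula for \<open>v \<mapsto> f(z + v (u - z))\<close> on the unit circle. The
  circle is described as the orbit of a point \<open>u\<close> under rotation about
  \<open>z\<close>, not by its radius, so that the inequality can afterwards be integrated over
  \<open>u\<close>.\<close>

lemma norm_le_circle_average:
  assumes "f holomorphic_on ball z R" "u \<in> ball z R"
  shows "ennreal (cmod (f z)) \<le> (\<integral>\<^sup>+t\<in>{0..1}. ennreal (cmod (f (z + exp (2 * pi * \<i> * of_real t) * (u - z)))) \<partial>lborel)"
proof -
  define F where "F v = f (z + v * (u - z))" for v
  have ball: "z + v * (u - z) \<in> ball z R" if "cmod v \<le> 1" for v
  proof -
    have "cmod (v * (u - z)) \<le> 1 * cmod (u - z)" unfolding norm_mult using that by (intro mult_right_mono) auto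
    then show ?thesis using assms(2) by (simp add: dist_norm norm_minus_commute)
  qed
  have contf: "continuous_on (ball z R) f" using assms(1) holomorphic_on_imp_continuous_on by blast
  have contF: "continuous_on (cball 0 1) F"
    unfolding F_def by (intro continuous_on_compose2[OF contf] continuous_intros) (use ball in auto)
  have "f \<circ> (\<lambda>v. z + v * (u - z)) holomorphic_on ball 0 1"
    by (intro holomorphic_on_compose_gen[OF _ assms(1)] holomorphic_intros) (use ball in auto)
  then have "F holomorphic_on ball 0 1" by (simp add: F_def[abs_def] o_def)
  then have ci: "((\<lambda>u. F u / (u - 0)) has_contour_integral (2 * of_real pi * \<i> * F 0)) (circlepath 0 1)"
    by (intro Cauchy_integral_circlepath contF) auto
  define e where "e t = exp (2 * pi * \<i> * complex_of_real t)" for t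
  have "((\<lambda>t. F (e t) / e t * (2 * pi * \<i> * e t)) has_integral (2 * of_real pi * \<i> * F 0)) {0..1}"
    using ci unfolding has_contour_integral_def
    by (rule has_integral_eq[rotated])
      (subst vector_derivative_circlepath01, auto simp: circlepath e_def)
  \<comment> \<open>The factor \<open>e t\<close> from the velocity of the path cancels the Cauchy
    denominator.\<close>
  then have "((\<lambda>t. (2 * pi * \<i>) * F (e t)) has_integral ((2 * of_real pi * \<i>) * F 0)) {0..1}"
    by (rule has_integral_eq[rotated]) (simp add: e_def)
  then have hi: "((\<lambda>t. F (e t)) has_integral F 0) {0..1}"
    by (subst (asm) has_integral_mult_right_iff) auto
  have conte: "continuous_on {0..1} (\<lambda>t. F (e t))"
    by (rule continuous_on_compose2[OF contF]) (auto simp: e_def norm_exp_eq_Re intro!: continuous_intros)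
  then have contn: "continuous_on {0..1} (\<lambda>t. cmod (F (e t)))" by (intro continuous_intros)
  have "cmod (F 0) \<le> integral {0..1} (\<lambda>t. cmod (F (e t)))"
    using hi integral_norm_bound_integral[OF integrable_continuous_real[OF conte] integrable_continuous_real[OF contn]]
    by (simp add: integral_unique)
  also have "ennreal \<dots> = (\<integral>\<^sup>+t\<in>{0..1}. ennreal (cmod (F (e t))) \<partial>lborel)"
  proof -
    have si: "set_integrable lborel {0..1} (\<lambda>t. cmod (F (e t)))"
      by (intro borel_integrable_atLeastAtMost' contn)
    then have "ennreal (LINT t:{0..1}|lborel. cmod (F (e t))) = (\<integral>\<^sup>+t. ennreal (indicator {0..1} t *\<^sub>R cmod (F (e t))) \<partial>lborel)"
      unfolding set_integrable_def set_lebesgue_integral_def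
      by (intro nn_integral_eq_integral[symmetric]) auto
    also have "\<dots> = (\<integral>\<^sup>+t\<in>{0..1}. ennreal (cmod (F (e t))) \<partial>lborel)"
      by (intro nn_integral_cong) (auto simp: indicator_def)
    finally show ?thesis using set_borel_integral_eq_integral(2)[OF si] by simp
  qed
  finally show ?thesis by (simp add: F_def e_def ennreal_leI)
qed

text \<open>Substitution by a rotation, whose derivative \<open>c\<close> has modulus 1. As an
  inequality the statement is immediate when the right side is infinite, and otherwise the
  finiteness required by the substitution is available.\<close>

lemma nn_integral_rotate_le:
  fixes f :: "complex \<Rightarrow> complex"
  assumes "continuous_on (ball z R) f" "cmod c = 1"
  shows "(\<integral>\<^sup>+u\<in>ball z R. ennreal (cmod (f (z + c * (u - z)))) \<partial>lborel) \<le> (\<integral>\<^sup>+u\<in>ball z R. ennreal (cmod (f u)) \<partial>lborel)"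
proof (cases "(\<integral>\<^sup>+u\<in>ball z R. ennreal (cmod (f u)) \<partial>lborel) < \<infinity>")
  case True
  define g where "g u = z + c * (u - z)" for u
  define F where "F u = cmod (indicator (ball z R) u *\<^sub>R f u)" for u
  have mF [measurable]: "F \<in> borel_measurable borel"
    unfolding F_def[abs_def]
    by (intro measurable_compose[OF _ borel_measurable_norm] borel_measurable_continuous_on_indicator assms(1)) auto
  have gb: "g u \<in> ball z R \<longleftrightarrow> u \<in> ball z R" for u
    using assms(2) by (simp add: g_def dist_norm norm_mult norm_minus_commute)
  have "c \<noteq> 0" using assms by auto
  have im: "g ` ball z R = ball z R"
  proof safe
    fix u assume u: "u \<in> ball z R"
    then show "g u \<in> ball z R" using gb by simp
    have "g (z + (u - z) / c) = u" using \<open>c \<noteq> 0\<close> by (simp add: g_def)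
    then show "u \<in> g ` ball z R" using gb u by (metis image_eqI)
  qed
  have der: "deriv g u = c" for u
    unfolding g_def[abs_def] by (rule DERIV_imp_deriv) (auto intro!: derivative_eq_intros)
  have 1: "(\<integral>\<^sup>+u\<in>ball z R. ennreal (cmod (f u)) \<partial>lborel) = (\<integral>\<^sup>+u\<in>g ` ball z R. ennreal (F u) \<partial>lborel)"
    unfolding im by (intro nn_integral_cong) (auto simp: F_def indicator_def)
  have "(\<integral>\<^sup>+u\<in>ball z R. ennreal ((cmod (deriv g u))\<^sup>2 * F (g u)) \<partial>lborel) = (\<integral>\<^sup>+u\<in>g ` ball z R. ennreal (F u) \<partial>lborel)"
    using True \<open>c \<noteq> 0\<close> unfolding 1
    by (intro nn_integral_change_of_variables_holomorphic mF)
      (auto simp: F_def g_def inj_on_def intro!: holomorphic_intros)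
  moreover have "(\<integral>\<^sup>+u\<in>ball z R. ennreal ((cmod (deriv g u))\<^sup>2 * F (g u)) \<partial>lborel) =
     (\<integral>\<^sup>+u\<in>ball z R. ennreal (cmod (f (z + c * (u - z)))) \<partial>lborel)"
    using gb by (intro nn_integral_cong) (auto simp: der assms F_def indicator_def g_def[symmetric])
  ultimately show ?thesis using 1 by simp
qed (simp add: not_less top_unique)

text \<open>Averaging the circle mean over all centred rotations replaces polar coordinates.\<close>

lemma norm_le_area_average:
  assumes f: "f holomorphic_on ball z R" and "R > 0"
  shows "ennreal (pi * R\<^sup>2) * ennreal (cmod (f z)) \<le> (\<integral>\<^sup>+u\<in>ball z R. ennreal (cmod (f u)) \<partial>lborel)"
proof -
  let ?g = "\<lambda>t u. z + exp (2 * pi * \<i> * of_real t) * (u - z)"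
  define F where "F u = cmod (indicator (ball z R) u *\<^sub>R f u)" for u
  have contf: "continuous_on (ball z R) f" using f holomorphic_on_imp_continuous_on by blast
  have mF [measurable]: "F \<in> borel_measurable borel"
    unfolding F_def[abs_def]
    by (intro measurable_compose[OF _ borel_measurable_norm] borel_measurable_continuous_on_indicator contf) auto
  have n1: "cmod (exp (2 * pi * \<i> * complex_of_real t)) = 1" for t by (simp add: norm_exp_eq_Re)
  have gb: "?g t u \<in> ball z R \<longleftrightarrow> u \<in> ball z R" for t u
    using n1 by (simp add: dist_norm norm_mult norm_minus_commute)
  have "ennreal (pi * R\<^sup>2) * ennreal (cmod (f z)) = (\<integral>\<^sup>+u\<in>ball z R. ennreal (cmod (f z)) \<partial>lborel)"
    using \<open>R > 0\<close> by (simp add: nn_integral_cmult_indicator emeasure_ball unit_ball_vol_2 mult.commute)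
  also have "\<dots> \<le> (\<integral>\<^sup>+u. \<integral>\<^sup>+t. ennreal (F (?g t u)) * indicator {0..1} t \<partial>lborel \<partial>lborel)"
  proof (rule nn_integral_mono)
    fix u
    show "ennreal (cmod (f z)) * indicator (ball z R) u \<le> (\<integral>\<^sup>+t. ennreal (F (?g t u)) * indicator {0..1} t \<partial>lborel)"
    proof (cases "u \<in> ball z R")
      case True
      then have "ennreal (cmod (f z)) \<le> (\<integral>\<^sup>+t\<in>{0..1}. ennreal (cmod (f (?g t u))) \<partial>lborel)"
        by (rule norm_le_circle_average[OF f])
      also have "\<dots> = (\<integral>\<^sup>+t. ennreal (F (?g t u)) * indicator {0..1} t \<partial>lborel)"
        using True gb by (intro nn_integral_cong) (auto simp: F_def)
      finally show ?thesis using True by simp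
    qed auto
  qed
  \<comment> \<open>With the angle outermost, each inner integral is a rotated disc integral, and
    the angles have total mass 1.\<close>
  also have "\<dots> = (\<integral>\<^sup>+t. \<integral>\<^sup>+u. ennreal (F (?g t u)) * indicator {0..1} t \<partial>lborel \<partial>lborel)"
    by (rule lborel_pair.Fubini') measurable
  also have "\<dots> \<le> (\<integral>\<^sup>+t\<in>{0..1}. (\<integral>\<^sup>+u\<in>ball z R. ennreal (cmod (f u)) \<partial>lborel) \<partial>(lborel :: real measure))"
  proof (rule nn_integral_mono)
    fix t :: real
    have "(\<integral>\<^sup>+u. ennreal (F (?g t u)) * indicator {0..1} t \<partial>lborel) =
      (\<integral>\<^sup>+u\<in>ball z R. ennreal (cmod (f (?g t u))) \<partial>lborel) * indicator {0..1} t"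
      using gb by (auto simp: F_def indicator_def intro!: nn_integral_cong)
    also have "\<dots> \<le> (\<integral>\<^sup>+u\<in>ball z R. ennreal (cmod (f u)) \<partial>lborel) * indicator {0..1} t"
      by (intro mult_right_mono nn_integral_rotate_le contf n1) auto
    finally show "(\<integral>\<^sup>+u. ennreal (F (?g t u)) * indicator {0..1} t \<partial>lborel) \<le> \<dots>" .
  qed
  also have "\<dots> = (\<integral>\<^sup>+u\<in>ball z R. ennreal (cmod (f u)) \<partial>lborel)"
    by (subst nn_integral_cmult_indicator) auto
  finally show ?thesis .
qed

subsection \<open>Domination by the kernel integral\<close>

lemma kernel_sq_nonneg [simp]: "kernel_sq \<alpha> w z \<ge> 0"
  by (simp add: kernel_sq_def)

lemma borel_measurable_cnj [measurable]: "cnj \<in> borel_measurable borel"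
  by (intro borel_measurable_continuous_onI continuous_intros)

lemma borel_measurable_kernel_sq [measurable]:
  assumes [measurable]: "f \<in> borel_measurable M" "g \<in> borel_measurable M"
  shows "(\<lambda>x. kernel_sq \<alpha> (f x) (g x)) \<in> borel_measurable M"
  unfolding kernel_sq_def by measurable

lemma cmod_one_minus_cnj_mult_ge:
  assumes "cmod w \<le> 1"
  shows "cmod (1 - cnj w * z) \<ge> 1 - cmod z"
proof -
  have "cmod (cnj w * z) \<le> 1 * cmod z" unfolding norm_mult using assms by (intro mult_right_mono) auto
  then show ?thesis using norm_triangle_ineq2[of 1 "cnj w * z"] by simp
qed

text \<open>Uniform in \<open>w\<close>; this is what makes point evaluation at \<open>z\<close>
  bounded.\<close>

lemma kernel_sq_le:
  assumes "\<alpha> > -1" "cmod w < 1" "cmod z < 1"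
  shows "kernel_sq \<alpha> w z \<le> (1 - cmod z) powr - (2 * \<alpha> + 4)"
proof -
  have "(1 - (cmod w)\<^sup>2) powr (2 + \<alpha>) \<le> 1"
    using assms by (intro powr_le1) (auto simp: abs_square_le_1)
  moreover have "(1 - cmod z) powr (2 * \<alpha> + 4) \<le> cmod (1 - cnj w * z) powr (2 * \<alpha> + 4)"
    using assms cmod_one_minus_cnj_mult_ge[of w z] by (intro powr_mono2) auto
  ultimately show ?thesis
    using assms unfolding kernel_sq_def powr_minus_divide by (intro frac_le) auto
qed

text \<open>Uniform in \<open>z\<close>, since \<open>|1 - cnj w z|\<close> is symmetric in the two
  points. It controls the kernel integrals for \<open>w\<close> in a smaller disc.\<close>

lemma kernel_sq_le':
  assumes "\<alpha> > -1" "cmod w < 1" "cmod z < 1"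
  shows "kernel_sq \<alpha> w z \<le> (1 - cmod w) powr - (2 * \<alpha> + 4)"
proof -
  have "(1 - (cmod w)\<^sup>2) powr (2 + \<alpha>) \<le> 1"
    using assms by (intro powr_le1) (auto simp: abs_square_le_1)
  moreover have "1 - cmod w \<le> cmod (1 - cnj w * z)"
    using cmod_one_minus_cnj_mult_ge[of z w] assms complex_mod_cnj[of "1 - cnj w * z"] by (simp add: mult.commute)
  then have "(1 - cmod w) powr (2 * \<alpha> + 4) \<le> cmod (1 - cnj w * z) powr (2 * \<alpha> + 4)"
    using assms by (intro powr_mono2) auto
  ultimately show ?thesis
    using assms unfolding kernel_sq_def powr_minus_divide by (intro frac_le) auto
qed

text \<open>On the disc of radius \<open>R = (1 - |z|) / 2\<close> around \<open>z\<close>, the weight times the squared kernel is at least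
  \<open>R powr (2 \<alpha> + 2) / (6 R) powr (2 \<alpha> + 4)\<close>; the constant turns this into \<open>1 / (\<pi> R^2)\<close>.\<close>

definition kernel_const :: "real \<Rightarrow> real" where
  "kernel_const \<alpha> = 4 / pi * 2 powr (2 * \<alpha> + 2) * 3 powr (2 * \<alpha> + 4)"

lemma kernel_const_pos: "kernel_const \<alpha> > 0" by (simp add: kernel_const_def)

lemma kernel_sq_lower_bound:
  assumes "\<alpha> > -1" "cmod z < 1" "u \<in> ball z ((1 - cmod z) / 2)"
  shows "cmod u < 1"
    "1 \<le> pi * ((1 - cmod z) / 2)\<^sup>2 * kernel_const \<alpha> * (bergman_weight \<alpha> u * kernel_sq \<alpha> u z)"
proof -
  define s where "s = 1 - cmod z"
  have s: "s > 0" "s \<le> 1" using assms by (auto simp: s_def)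
  have d: "cmod (z - u) < s / 2" using assms(3) by (simp add: s_def dist_norm)
  have "cmod u \<le> cmod z + cmod (z - u)" using norm_triangle_ineq4[of z "z - u"] by simp
  then have u: "1 - cmod u > s / 2" using d by (simp add: s_def)
  then show u1: "cmod u < 1" using s by simp
  define a where "a = 1 - (cmod u)\<^sup>2"
  have "a = (1 - cmod u) * (1 + cmod u)" by (simp add: a_def power2_eq_square algebra_simps)
  also have "\<dots> \<ge> (1 - cmod u) * 1" using u1 by (intro mult_left_mono) auto
  finally have a: "a \<ge> s / 2" using u by simp
  define b where "b = cmod (1 - cnj u * z)"
  have b0: "b > 0" using one_minus_cnj_mult_nonzero[of u z] u1 assms by (simp add: b_def)
  \<comment> \<open>Comparison with the diagonal value \<open>1 - |z|^2 \<le> 2 s\<close>; the error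
    is at most \<open>s / 2\<close>, so the total stays below \<open>3 s\<close>.\<close>
  have "1 - cnj u * z = of_real (1 - (cmod z)\<^sup>2) + cnj (z - u) * z"
    by (simp only: of_real_diff complex_norm_square complex_cnj_diff) (simp add: algebra_simps)
  then have "b \<le> cmod (complex_of_real (1 - (cmod z)\<^sup>2)) + cmod (cnj (z - u) * z)"
    unfolding b_def by (metis norm_triangle_ineq)
  also have "cmod (complex_of_real (1 - (cmod z)\<^sup>2)) = 1 - (cmod z)\<^sup>2"
    using assms by (simp only: norm_of_real) (simp add: abs_square_le_1)
  also have "1 - (cmod z)\<^sup>2 = s * (1 + cmod z)" by (simp add: s_def power2_eq_square algebra_simps)
  also have "s * (1 + cmod z) \<le> s * 2" using s assms by (intro mult_left_mono) auto
  also have "cmod (cnj (z - u) * z) \<le> s / 2 * 1"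
    unfolding norm_mult unfolding complex_mod_cnj using d assms(2) s(1) by (intro mult_mono) auto
  finally have b: "b \<le> 3 * s" using s by simp
  \<comment> \<open>The exponent \<alpha> of the weight may be negative, but together with the
    numerator \<open>a^(2+\<alpha>)\<close> of the kernel it becomes
    \<open>2\<alpha> + 2 > 0\<close>. A lower bound for \<open>a\<close> is therefore
    enough.\<close>
  have "(s / 2) powr (2 * \<alpha> + 2) / (3 * s) powr (2 * \<alpha> + 4) \<le> a powr (2 * \<alpha> + 2) / b powr (2 * \<alpha> + 4)"
    using assms s a b b0 by (intro frac_le powr_mono2) auto
  also have "\<dots> = bergman_weight \<alpha> u * kernel_sq \<alpha> u z"
    using powr_add[of a \<alpha> "2 + \<alpha>"]
    by (simp add: bergman_weight_def kernel_sq_def a_def[symmetric] b_def[symmetric] add.commute)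
  finally have ge: "(s / 2) powr (2 * \<alpha> + 2) / (3 * s) powr (2 * \<alpha> + 4) \<le> bergman_weight \<alpha> u * kernel_sq \<alpha> u z" .
  have e: "s powr (2 * \<alpha> + 4) = s powr (2 * \<alpha> + 2) * s\<^sup>2"
    using powr_add[of s "2 * \<alpha> + 2" 2] s by (simp add: add.commute)
  have "1 = pi * (s / 2)\<^sup>2 * kernel_const \<alpha> * ((s / 2) powr (2 * \<alpha> + 2) / (3 * s) powr (2 * \<alpha> + 4))"
  proof -
    have alg: "1 = pi * (s / 2)\<^sup>2 * (4 / pi * T * Q) * ((P / T) / (Q * (P * s\<^sup>2)))"
      if "P > 0" "T > 0" "Q > 0" for P T Q :: real
      using that s by (simp add: field_simps power2_eq_square)
    have "(s / 2) powr (2 * \<alpha> + 2) / (3 * s) powr (2 * \<alpha> + 4) =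
      (s powr (2 * \<alpha> + 2) / 2 powr (2 * \<alpha> + 2)) / (3 powr (2 * \<alpha> + 4) * (s powr (2 * \<alpha> + 2) * s\<^sup>2))"
      using s by (simp only: powr_divide powr_mult e)
    then show ?thesis
      unfolding kernel_const_def using s
      by (simp only:) (rule alg, auto)
  qed
  also have "\<dots> \<le> pi * (s / 2)\<^sup>2 * kernel_const \<alpha> * (bergman_weight \<alpha> u * kernel_sq \<alpha> u z)"
    using ge kernel_const_pos[of \<alpha>] by (intro mult_left_mono) auto
  finally show "1 \<le> pi * ((1 - cmod z) / 2)\<^sup>2 * kernel_const \<alpha> * (bergman_weight \<alpha> u * kernel_sq \<alpha> u z)"
    by (simp add: s_def)
qed

lemma borel_measurable_norm_sq_indicator:
  fixes f :: "complex \<Rightarrow> complex" and g :: "complex \<Rightarrow> real"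
  assumes f: "f holomorphic_on ball 0 1" and [measurable]: "g \<in> borel_measurable borel"
  shows "(\<lambda>u. ennreal ((cmod (f u))\<^sup>2 * g u) * indicator (ball 0 1) u) \<in> borel_measurable borel"
proof -
  have [measurable]: "(\<lambda>u. indicator (ball 0 1) u *\<^sub>R f u) \<in> borel_measurable borel"
    by (intro borel_measurable_continuous_on_indicator holomorphic_on_imp_continuous_on f) auto
  have "(\<lambda>u. ennreal ((cmod (f u))\<^sup>2 * g u) * indicator (ball 0 1) u)
      = (\<lambda>u. ennreal ((cmod (indicator (ball 0 1) u *\<^sub>R f u))\<^sup>2 * g u))"
    by (auto simp: indicator_def fun_eq_iff)
  moreover have "(\<lambda>u. ennreal ((cmod (indicator (ball 0 1) u *\<^sub>R f u))\<^sup>2 * g u)) \<in> borel_measurable borel"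
    by measurable
  ultimately show ?thesis by (simp only:)
qed

text \<open>The area inequality is applied to the holomorphic function \<open>f^2\<close>.
  Multiplying the integrand by the quantity from \<open>kernel_sq_lower_bound\<close>, which is at
  least 1, cancels the area of the small disc, and the integrand then extends to the whole unit
  disc, a domain that no longer depends on \<open>z\<close>.\<close>

lemma pointwise_le_kernel_integral:
  assumes \<alpha>: "\<alpha> > -1" and f: "f holomorphic_on ball 0 1" and z: "cmod z < 1"
  shows "ennreal ((cmod (f z))\<^sup>2) \<le> ennreal (kernel_const \<alpha>) *
    (\<integral>\<^sup>+u\<in>ball 0 1. ennreal ((cmod (f u))\<^sup>2 * bergman_weight \<alpha> u * kernel_sq \<alpha> u z) \<partial>lborel)"
    (is "_ \<le> ennreal ?C * ?I")
proof -
  define R where "R = (1 - cmod z) / 2"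
  have R: "R > 0" using z by (simp add: R_def)
  have sub: "ball z R \<subseteq> ball 0 1"
    using kernel_sq_lower_bound(1)[OF \<alpha> z] by (auto simp: R_def)
  have m: "(\<lambda>u. ennreal ((cmod (f u))\<^sup>2 * bergman_weight \<alpha> u * kernel_sq \<alpha> u z) * indicator (ball 0 1) u)
      \<in> borel_measurable borel"
    using borel_measurable_norm_sq_indicator[OF f, of "\<lambda>u. bergman_weight \<alpha> u * kernel_sq \<alpha> u z"]
    by (simp add: mult.assoc)
  have "ennreal (pi * R\<^sup>2) * ennreal ((cmod (f z))\<^sup>2) \<le> (\<integral>\<^sup>+u\<in>ball z R. ennreal (cmod ((f u)\<^sup>2)) \<partial>lborel)"
    using norm_le_area_average[of "\<lambda>u. (f u)\<^sup>2" z R] R holomorphic_on_subset[OF f sub]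
    by (auto intro!: holomorphic_intros simp: norm_power)
  also have "\<dots> \<le> (\<integral>\<^sup>+u. ennreal (pi * R\<^sup>2) * (ennreal ?C *
      (ennreal ((cmod (f u))\<^sup>2 * bergman_weight \<alpha> u * kernel_sq \<alpha> u z) * indicator (ball 0 1) u)) \<partial>lborel)"
  proof (rule nn_integral_mono)
    fix u
    show "ennreal (cmod ((f u)\<^sup>2)) * indicator (ball z R) u \<le> ennreal (pi * R\<^sup>2) * (ennreal ?C *
      (ennreal ((cmod (f u))\<^sup>2 * bergman_weight \<alpha> u * kernel_sq \<alpha> u z) * indicator (ball 0 1) u))"
    proof (cases "u \<in> ball z R")
      case True
      have "(cmod (f u))\<^sup>2 * 1 \<le> (cmod (f u))\<^sup>2 * (pi * R\<^sup>2 * ?C * (bergman_weight \<alpha> u * kernel_sq \<alpha> u z))"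
        using kernel_sq_lower_bound(2)[OF \<alpha> z True[unfolded R_def]]
        by (intro mult_left_mono) (auto simp: R_def)
      then show ?thesis using True sub kernel_const_pos[of \<alpha>]
        by (auto simp: norm_power ennreal_mult[symmetric] mult_ac intro!: ennreal_leI)
    qed auto
  qed
  also have "\<dots> = ennreal (pi * R\<^sup>2) * (ennreal ?C * ?I)"
    using m by (simp add: nn_integral_cmult)
  finally show ?thesis
    using R by (subst (asm) ennreal_mult_le_mult_iff) auto
qed

text \<open>The squared norm without the factor \<open>1 / \<pi>\<close>. The value \<infinity>
  marks holomorphic functions outside the space, so estimates carry no integrability
  conditions.\<close>

definition bergman_nn :: "real \<Rightarrow> (complex \<Rightarrow> complex) \<Rightarrow> ennreal" where
  "bergman_nn \<alpha> f = (\<integral>\<^sup>+z\<in>ball 0 1. ennreal ((cmod (f z))\<^sup>2 * bergman_weight \<alpha> z) \<partial>lborel)"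

text \<open>Bounded point evaluations, with a constant that is locally uniform in \<open>z\<close>:
  the hypothesis of Montel's theorem.\<close>

lemma pointwise_le_bergman_nn:
  assumes \<alpha>: "\<alpha> > -1" and f: "f holomorphic_on ball 0 1" and z: "cmod z < 1"
  shows "ennreal ((cmod (f z))\<^sup>2) \<le>
    ennreal (kernel_const \<alpha> * (1 - cmod z) powr - (2 * \<alpha> + 4)) * bergman_nn \<alpha> f"
proof -
  let ?q = "(1 - cmod z) powr - (2 * \<alpha> + 4)"
  have m: "(\<lambda>u. ennreal ((cmod (f u))\<^sup>2 * bergman_weight \<alpha> u) * indicator (ball 0 1) u) \<in> borel_measurable borel"
    by (rule borel_measurable_norm_sq_indicator[OF f borel_measurable_bergman_weight])
  have "(\<integral>\<^sup>+u\<in>ball 0 1. ennreal ((cmod (f u))\<^sup>2 * bergman_weight \<alpha> u * kernel_sq \<alpha> u z) \<partial>lborel)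
    \<le> (\<integral>\<^sup>+u. ennreal ?q * (ennreal ((cmod (f u))\<^sup>2 * bergman_weight \<alpha> u) * indicator (ball 0 1) u) \<partial>lborel)"
  proof (rule nn_integral_mono)
    fix u :: complex
    show "ennreal ((cmod (f u))\<^sup>2 * bergman_weight \<alpha> u * kernel_sq \<alpha> u z) * indicator (ball 0 1) u
      \<le> ennreal ?q * (ennreal ((cmod (f u))\<^sup>2 * bergman_weight \<alpha> u) * indicator (ball 0 1) u)"
    proof (cases "u \<in> ball 0 1")
      case True
      then have "(cmod (f u))\<^sup>2 * bergman_weight \<alpha> u * kernel_sq \<alpha> u z \<le> (cmod (f u))\<^sup>2 * bergman_weight \<alpha> u * ?q"
        using kernel_sq_le[OF \<alpha> _ z, of u] by (intro mult_left_mono) auto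
      also have "\<dots> = ?q * ((cmod (f u))\<^sup>2 * bergman_weight \<alpha> u)" by (rule mult.commute)
      finally show ?thesis using True by (simp only: indicator_simps ennreal_mult[symmetric]) (simp add: ennreal_leI flip: ennreal_mult)
    qed auto
  qed
  also have "\<dots> = ennreal ?q * bergman_nn \<alpha> f"
    unfolding bergman_nn_def using m by (simp add: nn_integral_cmult)
  finally have "ennreal (kernel_const \<alpha>) * (\<integral>\<^sup>+u\<in>ball 0 1. ennreal ((cmod (f u))\<^sup>2 * bergman_weight \<alpha> u * kernel_sq \<alpha> u z) \<partial>lborel)
    \<le> ennreal (kernel_const \<alpha>) * (ennreal ?q * bergman_nn \<alpha> f)"
    by (intro mult_left_mono) auto
  also have "\<dots> = ennreal (kernel_const \<alpha> * ?q) * bergman_nn \<alpha> f"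
    using kernel_const_pos[of \<alpha>] by (simp add: ennreal_mult mult_ac)
  finally show ?thesis
    using pointwise_le_kernel_integral[OF \<alpha> f z] by (rule order_trans[rotated])
qed

text \<open>The pointwise bound is integrated in \<open>z\<close> and the order of integration
  exchanged; finiteness of \<open>\<mu>\<close> makes the product \<sigma>-finite.\<close>

lemma nn_integral_le_kernel_integral:
  fixes \<mu> :: "complex measure"
  assumes \<alpha>: "\<alpha> > -1" and f: "f holomorphic_on ball 0 1"
    and fin: "finite_measure \<mu>" and sets_eq: "sets \<mu> = sets (restrict_space borel (ball 0 1))"
  shows "(\<integral>\<^sup>+z. ennreal ((cmod (f z))\<^sup>2) \<partial>\<mu>) \<le> ennreal (kernel_const \<alpha>) *
    (\<integral>\<^sup>+u\<in>ball 0 1. ennreal ((cmod (f u))\<^sup>2 * bergman_weight \<alpha> u) * (\<integral>\<^sup>+z. ennreal (kernel_sq \<alpha> u z) \<partial>\<mu>) \<partial>lborel)"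
proof -
  interpret finite_measure \<mu> by fact
  interpret pair_sigma_finite "lborel :: complex measure" \<mu> ..
  have space: "space \<mu> = ball 0 1"
    using sets_eq_imp_space_eq[OF sets_eq] by (simp add: space_restrict_space)
  have "(\<lambda>z. z) \<in> borel_measurable (restrict_space borel (ball 0 1))"
    by (intro measurable_restrict_space1) auto
  then have [measurable]: "(\<lambda>z. z) \<in> borel_measurable \<mu>"
    by (simp cong: measurable_cong_sets add: sets_eq)
  \<comment> \<open>The outer integral runs over the whole plane, where \<open>f\<close> itself need
    not be measurable.\<close>
  define F where "F = (\<lambda>u. indicator (ball 0 1) u *\<^sub>R f u)"
  have [measurable]: "F \<in> borel_measurable borel" unfolding F_def
    by (intro borel_measurable_continuous_on_indicator holomorphic_on_imp_continuous_on f) auto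
  define G where "G u z = ennreal ((cmod (F u))\<^sup>2 * bergman_weight \<alpha> u) * ennreal (kernel_sq \<alpha> u z)" for u z
  have mG: "(\<lambda>(u, z). G u z) \<in> borel_measurable (lborel \<Otimes>\<^sub>M \<mu>)"
    and mG2: "(\<lambda>(z, u). G u z) \<in> borel_measurable (\<mu> \<Otimes>\<^sub>M lborel)"
    unfolding G_def case_prod_beta by measurable
  have "(\<integral>\<^sup>+z. ennreal ((cmod (f z))\<^sup>2) \<partial>\<mu>) \<le> (\<integral>\<^sup>+z. ennreal (kernel_const \<alpha>) * (\<integral>\<^sup>+u. G u z \<partial>lborel) \<partial>\<mu>)"
  proof (rule nn_integral_mono)
    fix z assume "z \<in> space \<mu>"
    then have z: "cmod z < 1" by (simp add: space)
    have "(\<integral>\<^sup>+u\<in>ball 0 1. ennreal ((cmod (f u))\<^sup>2 * bergman_weight \<alpha> u * kernel_sq \<alpha> u z) \<partial>lborel)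
       = (\<integral>\<^sup>+u. G u z \<partial>lborel)"
      by (intro nn_integral_cong) (auto simp: G_def F_def indicator_def ennreal_mult)
    then show "ennreal ((cmod (f z))\<^sup>2) \<le> ennreal (kernel_const \<alpha>) * (\<integral>\<^sup>+u. G u z \<partial>lborel)"
      using pointwise_le_kernel_integral[OF \<alpha> f z] by simp
  qed
  also have "\<dots> = ennreal (kernel_const \<alpha>) * (\<integral>\<^sup>+z. \<integral>\<^sup>+u. G u z \<partial>lborel \<partial>\<mu>)"
    by (rule nn_integral_cmult[OF lborel.borel_measurable_nn_integral[OF mG2]])
  also have "(\<integral>\<^sup>+z. \<integral>\<^sup>+u. G u z \<partial>lborel \<partial>\<mu>) = (\<integral>\<^sup>+u. \<integral>\<^sup>+z. G u z \<partial>\<mu> \<partial>lborel)"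
    by (rule Fubini'[OF mG])
  also have "\<dots> = (\<integral>\<^sup>+u\<in>ball 0 1. ennreal ((cmod (f u))\<^sup>2 * bergman_weight \<alpha> u) * (\<integral>\<^sup>+z. ennreal (kernel_sq \<alpha> u z) \<partial>\<mu>) \<partial>lborel)"
    unfolding G_def by (intro nn_integral_cong, subst nn_integral_cmult) (auto simp: F_def indicator_def)
  finally show ?thesis .
qed

subsection \<open>The Bergman space\<close>

lemma bergman_space_iff:
  "f \<in> bergman_space \<alpha> \<longleftrightarrow> f holomorphic_on ball 0 1 \<and> bergman_nn \<alpha> f < \<infinity>"
proof (cases "f holomorphic_on ball 0 1")
  case True
  have "(\<lambda>z. ennreal (indicator (ball 0 1) z *\<^sub>R ((cmod (f z))\<^sup>2 * bergman_weight \<alpha> z)))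
      = (\<lambda>z. ennreal ((cmod (f z))\<^sup>2 * bergman_weight \<alpha> z) * indicator (ball 0 1) z)"
    by (auto simp: indicator_def fun_eq_iff)
  moreover have "(\<lambda>z. indicator (ball 0 1) z *\<^sub>R ((cmod (f z))\<^sup>2 * bergman_weight \<alpha> z)) \<in> borel_measurable lborel"
  proof -
    have "(\<lambda>z. enn2real (ennreal ((cmod (f z))\<^sup>2 * bergman_weight \<alpha> z) * indicator (ball 0 1) z)) \<in> borel_measurable lborel"
      using borel_measurable_norm_sq_indicator[OF True borel_measurable_bergman_weight] by simp
    also have "(\<lambda>z. enn2real (ennreal ((cmod (f z))\<^sup>2 * bergman_weight \<alpha> z) * indicator (ball 0 1) z)) =
       (\<lambda>z. indicator (ball 0 1) z *\<^sub>R ((cmod (f z))\<^sup>2 * bergman_weight \<alpha> z))"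
      by (auto simp: indicator_def fun_eq_iff)
    finally show ?thesis .
  qed
  ultimately show ?thesis
    using True unfolding bergman_space_def set_integrable_def bergman_nn_def
    by (auto simp: integrable_iff_bounded abs_mult)
qed (auto simp: bergman_space_def)

lemma bergman_nn_eq_norm:
  assumes "f \<in> bergman_space \<alpha>"
  shows "bergman_nn \<alpha> f = ennreal (pi * (bergman_norm \<alpha> f)\<^sup>2)"
proof -
  have si: "set_integrable lborel (ball 0 1) (\<lambda>z. (cmod (f z))\<^sup>2 * bergman_weight \<alpha> z)"
    using assms by (simp add: bergman_space_def)
  have "bergman_nn \<alpha> f = (\<integral>\<^sup>+z. ennreal (indicator (ball 0 1) z *\<^sub>R ((cmod (f z))\<^sup>2 * bergman_weight \<alpha> z)) \<partial>lborel)"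
    unfolding bergman_nn_def by (intro nn_integral_cong) (auto simp: indicator_def)
  also have "\<dots> = ennreal (LINT z:ball 0 1|lborel. (cmod (f z))\<^sup>2 * bergman_weight \<alpha> z)"
    using si unfolding set_integrable_def set_lebesgue_integral_def
    by (intro nn_integral_eq_integral) auto
  also have "(LINT z:ball 0 1|lborel. (cmod (f z))\<^sup>2 * bergman_weight \<alpha> z) = pi * (bergman_norm \<alpha> f)\<^sup>2"
    unfolding bergman_norm_def
    by (subst real_sqrt_pow2) (auto simp: set_lebesgue_integral_def intro!: integral_nonneg_AE)
  finally show ?thesis .
qed

lemma bergman_norm_nonneg: "bergman_norm \<alpha> f \<ge> 0"
  unfolding bergman_norm_def by (auto simp: set_lebesgue_integral_def intro!: integral_nonneg_AE)

text \<open>Stands in for the triangle inequality of the norms: it works on squares under the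
  integral sign, and the factor 2 is harmless for boundedness and for limits 0.\<close>

lemma norm_add_sq_le: "(cmod (a + b))\<^sup>2 \<le> 2 * (cmod a)\<^sup>2 + 2 * (cmod b)\<^sup>2"
proof -
  have "(cmod (a + b))\<^sup>2 \<le> (cmod a + cmod b)\<^sup>2" by (intro power_mono norm_triangle_ineq) auto
  also have "\<dots> \<le> 2 * (cmod a)\<^sup>2 + 2 * (cmod b)\<^sup>2"
    using sum_squares_bound[of "cmod a" "cmod b"] by (simp add: power2_sum)
  finally show ?thesis .
qed

lemma bergman_nn_add_le:
  assumes "f holomorphic_on ball 0 1" "g holomorphic_on ball 0 1"
  shows "bergman_nn \<alpha> (\<lambda>z. f z + g z) \<le> 2 * bergman_nn \<alpha> f + 2 * bergman_nn \<alpha> g"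
proof -
  note m = borel_measurable_norm_sq_indicator[OF _ borel_measurable_bergman_weight]
  have "bergman_nn \<alpha> (\<lambda>z. f z + g z) \<le>
     (\<integral>\<^sup>+z. 2 * (ennreal ((cmod (f z))\<^sup>2 * bergman_weight \<alpha> z) * indicator (ball 0 1) z) +
       2 * (ennreal ((cmod (g z))\<^sup>2 * bergman_weight \<alpha> z) * indicator (ball 0 1) z) \<partial>lborel)"
    unfolding bergman_nn_def
  proof (rule nn_integral_mono)
    fix z
    have "(cmod (f z + g z))\<^sup>2 * bergman_weight \<alpha> z \<le>
       (2 * (cmod (f z))\<^sup>2 + 2 * (cmod (g z))\<^sup>2) * bergman_weight \<alpha> z"
      by (intro mult_right_mono norm_add_sq_le) auto
    also have "\<dots> = 2 * ((cmod (f z))\<^sup>2 * bergman_weight \<alpha> z) + 2 * ((cmod (g z))\<^sup>2 * bergman_weight \<alpha> z)"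
      by (simp add: algebra_simps)
    finally have "ennreal ((cmod (f z + g z))\<^sup>2 * bergman_weight \<alpha> z) \<le>
      ennreal (2 * ((cmod (f z))\<^sup>2 * bergman_weight \<alpha> z) + 2 * ((cmod (g z))\<^sup>2 * bergman_weight \<alpha> z))"
      by (rule ennreal_leI)
    also have "\<dots> = 2 * ennreal ((cmod (f z))\<^sup>2 * bergman_weight \<alpha> z) + 2 * ennreal ((cmod (g z))\<^sup>2 * bergman_weight \<alpha> z)"
      by (subst ennreal_plus) (simp_all only: ennreal_mult'' ennreal_numeral zero_le_numeral bergman_weight_nonneg zero_le_power2 mult_nonneg_nonneg
        ennreal_mult[of 2])
    finally show "ennreal ((cmod (f z + g z))\<^sup>2 * bergman_weight \<alpha> z) * indicator (ball 0 1) z \<le>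
       2 * (ennreal ((cmod (f z))\<^sup>2 * bergman_weight \<alpha> z) * indicator (ball 0 1) z) +
       2 * (ennreal ((cmod (g z))\<^sup>2 * bergman_weight \<alpha> z) * indicator (ball 0 1) z)"
      by (auto simp: indicator_def)
  qed
  also have "\<dots> = 2 * bergman_nn \<alpha> f + 2 * bergman_nn \<alpha> g"
    unfolding bergman_nn_def using m[OF assms(1)] m[OF assms(2)]
    by (simp add: nn_integral_add nn_integral_cmult)
  finally show ?thesis .
qed

lemma bergman_nn_cmult:
  assumes "f holomorphic_on ball 0 1"
  shows "bergman_nn \<alpha> (\<lambda>z. c * f z) = ennreal ((cmod c)\<^sup>2) * bergman_nn \<alpha> f"
  unfolding bergman_nn_def
  by (subst nn_integral_cmult[symmetric])
    (use borel_measurable_norm_sq_indicator[OF assms borel_measurable_bergman_weight] in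
      \<open>auto simp: norm_mult power_mult_distrib indicator_def ennreal_mult mult.assoc intro!: nn_integral_cong\<close>)

lemma bergman_space_add:
  "f \<in> bergman_space \<alpha> \<Longrightarrow> g \<in> bergman_space \<alpha> \<Longrightarrow> (\<lambda>z. f z + g z) \<in> bergman_space \<alpha>"
  using bergman_nn_add_le[of f g \<alpha>]
  by (auto simp: bergman_space_iff ennreal_mult_less_top intro!: holomorphic_intros elim!: le_less_trans)

lemma bergman_space_cmult:
  "f \<in> bergman_space \<alpha> \<Longrightarrow> (\<lambda>z. c * f z) \<in> bergman_space \<alpha>"
  by (auto simp: bergman_space_iff bergman_nn_cmult ennreal_mult_less_top intro!: holomorphic_intros)

lemma bergman_space_diff:
  assumes "f \<in> bergman_space \<alpha>" "g \<in> bergman_space \<alpha>"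
  shows "(\<lambda>z. f z - g z) \<in> bergman_space \<alpha>"
  using bergman_space_add[OF assms(1) bergman_space_cmult[OF assms(2), of "-1"]] by simp

lemma bergman_nn_diff_le:
  assumes "f holomorphic_on ball 0 1" "g holomorphic_on ball 0 1"
  shows "bergman_nn \<alpha> (\<lambda>z. f z - g z) \<le> 2 * bergman_nn \<alpha> f + 2 * bergman_nn \<alpha> g"
  using bergman_nn_add_le[of f "\<lambda>z. - 1 * g z" \<alpha>] bergman_nn_cmult[of g \<alpha> "-1"] assms
  by (auto intro!: holomorphic_intros)

lemma bergman_nn_bergman_kernel:
  assumes "\<alpha> > -1" "cmod w < 1"
  shows "bergman_nn \<alpha> (bergman_kernel \<alpha> w) = bergman_nn \<alpha> (\<lambda>_. 1)"
  using nn_integral_bergman_kernel[OF assms] by (simp add: bergman_nn_def)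

lemma bergman_nn_one_finite: "\<alpha> > -1 \<Longrightarrow> bergman_nn \<alpha> (\<lambda>_. 1) < \<infinity>"
  using nn_integral_bergman_weight_finite by (simp add: bergman_nn_def)

lemma bergman_kernel_in_space:
  "\<alpha> > -1 \<Longrightarrow> cmod w < 1 \<Longrightarrow> bergman_kernel \<alpha> w \<in> bergman_space \<alpha>"
  unfolding bergman_space_iff
  by (auto simp: bergman_nn_bergman_kernel bergman_nn_one_finite[simplified] intro!: bergman_kernel_holomorphic)

text \<open>For fixed \<open>z\<close> the denominator stays at least a positive power of
  \<open>1 - |z|\<close> while the numerator tends to 0. Pointwise convergence is the form that
  Fatou's lemma will use.\<close>

lemma tendsto_bergman_kernel_0:
  assumes \<alpha>: "\<alpha> > -1" and w: "\<And>n. cmod (w n) < 1" "(\<lambda>n. cmod (w n)) \<longlonglongrightarrow> 1" and z: "cmod z < 1"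
  shows "(\<lambda>n. bergman_kernel \<alpha> (w n) z) \<longlonglongrightarrow> 0"
proof -
  have "(\<lambda>n. (1 - (cmod (w n))\<^sup>2) powr (2 + \<alpha>) / (1 - cmod z) powr (2 * \<alpha> + 4)) \<longlonglongrightarrow> (1 - 1\<^sup>2) powr (2 + \<alpha>) / (1 - cmod z) powr (2 * \<alpha> + 4)"
    using \<alpha> z w by (intro tendsto_intros tendsto_powr') (auto simp: abs_square_le_1 less_imp_le intro!: always_eventually)
  then have lim: "(\<lambda>n. (1 - (cmod (w n))\<^sup>2) powr (2 + \<alpha>) / (1 - cmod z) powr (2 * \<alpha> + 4)) \<longlonglongrightarrow> 0"
    by simp
  have "(\<lambda>n. (cmod (bergman_kernel \<alpha> (w n) z))\<^sup>2) \<longlonglongrightarrow> 0"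
  proof (rule tendsto_sandwich[OF _ _ tendsto_const lim])
    show "\<forall>\<^sub>F n in sequentially. (cmod (bergman_kernel \<alpha> (w n) z))\<^sup>2 \<le> (1 - (cmod (w n))\<^sup>2) powr (2 + \<alpha>) / (1 - cmod z) powr (2 * \<alpha> + 4)"
    proof (intro always_eventually allI)
      fix n
      have "(1 - cmod z) powr (2 * \<alpha> + 4) \<le> cmod (1 - cnj (w n) * z) powr (2 * \<alpha> + 4)"
        using \<alpha> z w(1)[of n] cmod_one_minus_cnj_mult_ge[of "w n" z] by (intro powr_mono2) auto
      then show "(cmod (bergman_kernel \<alpha> (w n) z))\<^sup>2 \<le> (1 - (cmod (w n))\<^sup>2) powr (2 + \<alpha>) / (1 - cmod z) powr (2 * \<alpha> + 4)"
        unfolding cmod_bergman_kernel_sq[OF w(1)] kernel_sq_def using z by (intro divide_left_mono) (auto intro!: mult_pos_pos)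
    qed
  qed auto
  from tendsto_real_sqrt[OF this] show ?thesis by (simp add: tendsto_norm_zero_iff)
qed

section \<open>Integrals of \<open>|f|^2\<close> against a finite measure, and normal
  families\<close>

lemma nn_integral_le_of_kernel_bound:
  fixes \<mu> :: "complex measure"
  assumes \<alpha>: "\<alpha> > -1" and f: "f holomorphic_on ball 0 1"
    and fin: "finite_measure \<mu>" and sets_eq: "sets \<mu> = sets (restrict_space borel (ball 0 1))"
    and M: "\<And>u. cmod u < 1 \<Longrightarrow> (\<integral>\<^sup>+z. ennreal (kernel_sq \<alpha> u z) \<partial>\<mu>) \<le> ennreal M"
  shows "(\<integral>\<^sup>+z. ennreal ((cmod (f z))\<^sup>2) \<partial>\<mu>) \<le> ennreal (kernel_const \<alpha>) * (ennreal M * bergman_nn \<alpha> f)"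
proof -
  have "(\<integral>\<^sup>+u\<in>ball 0 1. ennreal ((cmod (f u))\<^sup>2 * bergman_weight \<alpha> u) * (\<integral>\<^sup>+z. ennreal (kernel_sq \<alpha> u z) \<partial>\<mu>) \<partial>lborel)
    \<le> (\<integral>\<^sup>+u. ennreal M * (ennreal ((cmod (f u))\<^sup>2 * bergman_weight \<alpha> u) * indicator (ball 0 1) u) \<partial>lborel)"
    using M by (intro nn_integral_mono) (auto simp: indicator_def mult.commute[of _ "ennreal M"]
        mult.commute[of _ "nn_integral _ _"] intro!: mult_right_mono)
  also have "\<dots> = ennreal M * bergman_nn \<alpha> f"
    unfolding bergman_nn_def
    using borel_measurable_norm_sq_indicator[OF f borel_measurable_bergman_weight]
    by (simp add: nn_integral_cmult)
  finally show ?thesis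
    using nn_integral_le_kernel_integral[OF \<alpha> f fin sets_eq]
    by (meson mult_left_mono order_trans zero_le)
qed

text \<open>The kernel integral is split at radius \<rho>. Inside, \<open>|F n|^2\<close> is small
  by uniform convergence while the inner integral is at most \<open>M\<close>; outside, the inner
  integral is small while the norms of \<open>F n\<close> stay bounded.\<close>

lemma eventually_nn_integral_le_of_vanishing:
  fixes \<mu> :: "complex measure" and F :: "nat \<Rightarrow> complex \<Rightarrow> complex"
  assumes \<alpha>: "\<alpha> > -1" and F: "\<And>n. F n holomorphic_on ball 0 1"
    and B: "\<And>n. bergman_nn \<alpha> (F n) \<le> ennreal B"
    and unif: "\<And>\<rho>. \<rho> < 1 \<Longrightarrow> uniform_limit (cball 0 \<rho>) F (\<lambda>_. 0) sequentially"
    and fin: "finite_measure \<mu>" and sets_eq: "sets \<mu> = sets (restrict_space borel (ball 0 1))"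
    and M: "\<And>u. cmod u < 1 \<Longrightarrow> (\<integral>\<^sup>+z. ennreal (kernel_sq \<alpha> u z) \<partial>\<mu>) \<le> ennreal M"
    and van: "\<And>e. e > 0 \<Longrightarrow> \<exists>\<rho><1. \<forall>u. \<rho> < cmod u \<and> cmod u < 1 \<longrightarrow> (\<integral>\<^sup>+z. ennreal (kernel_sq \<alpha> u z) \<partial>\<mu>) \<le> ennreal e"
    and "e > 0"
  shows "\<forall>\<^sub>F n in sequentially. (\<integral>\<^sup>+z. ennreal ((cmod (F n z))\<^sup>2) \<partial>\<mu>) \<le> ennreal e"
proof -
  let ?K = "\<lambda>u. \<integral>\<^sup>+z. ennreal (kernel_sq \<alpha> u z) \<partial>\<mu>"
  let ?C = "kernel_const \<alpha>"
  obtain W0 where W0: "bergman_nn \<alpha> (\<lambda>_. 1) = ennreal W0" "W0 \<ge> 0"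
    using bergman_nn_one_finite[OF \<alpha>] by (cases "bergman_nn \<alpha> (\<lambda>_. 1)") auto
  \<comment> \<open>The two parts add up to at most \<open>\<epsilon> (|B| + |M| W0)\<close>, times
    the kernel constant. The summand 1 keeps the divisor positive, and absolute values are taken
    because \<open>B\<close> and \<open>M\<close> are arbitrary reals.\<close>
  define D where "D = ?C * (\<bar>B\<bar> + \<bar>M\<bar> * W0) + 1"
  have D: "D > 0" using kernel_const_pos[of \<alpha>] W0 by (auto simp: D_def intro!: add_nonneg_pos mult_nonneg_nonneg)
  define \<epsilon> where "\<epsilon> = e / D"
  have \<epsilon>: "\<epsilon> > 0" using \<open>e > 0\<close> D by (simp add: \<epsilon>_def)
  obtain \<rho> where \<rho>: "\<rho> < 1" "\<And>u. \<rho> < cmod u \<Longrightarrow> cmod u < 1 \<Longrightarrow> ?K u \<le> ennreal \<epsilon>"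
    using van[OF \<epsilon>] by auto
  have "\<forall>\<^sub>F n in sequentially. \<forall>u\<in>cball 0 \<rho>. dist (F n u) 0 < sqrt \<epsilon>"
    using unif[OF \<rho>(1)] \<epsilon> unfolding uniform_limit_iff by simp
  then show ?thesis
  proof eventually_elim
    case (elim n)
    note m = borel_measurable_norm_sq_indicator[OF _ borel_measurable_bergman_weight, of _ \<alpha>]
    have m1: "(\<lambda>u. ennreal (bergman_weight \<alpha> u) * indicator (ball 0 1) u) \<in> borel_measurable borel"
      using m[of "\<lambda>_. 1"] by simp
    have "(\<integral>\<^sup>+u\<in>ball 0 1. ennreal ((cmod (F n u))\<^sup>2 * bergman_weight \<alpha> u) * ?K u \<partial>lborel)
      \<le> (\<integral>\<^sup>+u. ennreal \<epsilon> * (ennreal ((cmod (F n u))\<^sup>2 * bergman_weight \<alpha> u) * indicator (ball 0 1) u) +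
           ennreal \<epsilon> * ennreal \<bar>M\<bar> * (ennreal (bergman_weight \<alpha> u) * indicator (ball 0 1) u) \<partial>lborel)"
    proof (rule nn_integral_mono)
      fix u
      show "ennreal ((cmod (F n u))\<^sup>2 * bergman_weight \<alpha> u) * ?K u * indicator (ball 0 1) u
        \<le> ennreal \<epsilon> * (ennreal ((cmod (F n u))\<^sup>2 * bergman_weight \<alpha> u) * indicator (ball 0 1) u) +
           ennreal \<epsilon> * ennreal \<bar>M\<bar> * (ennreal (bergman_weight \<alpha> u) * indicator (ball 0 1) u)"
      proof (cases "u \<in> ball 0 1")
        case u: True
        show ?thesis
        proof (cases "cmod u \<le> \<rho>")
          case True
          have "?K u \<le> ennreal \<bar>M\<bar>"
            using M[of u] u by (auto intro: order_trans ennreal_leI)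
          moreover have "ennreal ((cmod (F n u))\<^sup>2 * bergman_weight \<alpha> u) \<le> ennreal (\<epsilon> * bergman_weight \<alpha> u)"
          proof (intro ennreal_leI mult_right_mono)
            have "(cmod (F n u))\<^sup>2 \<le> (sqrt \<epsilon>)\<^sup>2"
              using elim True by (intro power_mono) (auto simp: less_imp_le)
            then show "(cmod (F n u))\<^sup>2 \<le> \<epsilon>" using \<epsilon> by simp
          qed auto
          ultimately have "ennreal ((cmod (F n u))\<^sup>2 * bergman_weight \<alpha> u) * ?K u \<le> ennreal (\<epsilon> * bergman_weight \<alpha> u) * ennreal \<bar>M\<bar>"
            by (intro mult_mono) auto
          also have "\<dots> = ennreal \<epsilon> * ennreal \<bar>M\<bar> * ennreal (bergman_weight \<alpha> u)"
            using \<epsilon> by (simp add: ennreal_mult mult_ac)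
          finally show ?thesis using u by (simp add: add_increasing)
        next
          case False
          then have "?K u \<le> ennreal \<epsilon>" using \<rho>(2)[of u] u by simp
          then have "ennreal ((cmod (F n u))\<^sup>2 * bergman_weight \<alpha> u) * ?K u \<le> ennreal ((cmod (F n u))\<^sup>2 * bergman_weight \<alpha> u) * ennreal \<epsilon>"
            by (rule mult_left_mono) simp
          then show ?thesis using u by (simp add: mult.commute add_increasing2)
        qed
      qed auto
    qed
    also have "\<dots> = ennreal \<epsilon> * bergman_nn \<alpha> (F n) + ennreal \<epsilon> * ennreal \<bar>M\<bar> * bergman_nn \<alpha> (\<lambda>_. 1)"
      unfolding bergman_nn_def using m[OF F[of n]] m1
      by (simp add: nn_integral_add nn_integral_cmult)
    also have "\<dots> \<le> ennreal \<epsilon> * ennreal \<bar>B\<bar> + ennreal \<epsilon> * ennreal \<bar>M\<bar> * ennreal W0"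
      unfolding W0 by (intro add_right_mono mult_left_mono order_trans[OF B] ennreal_leI) auto
    also have "\<dots> = ennreal (\<epsilon> * (\<bar>B\<bar> + \<bar>M\<bar> * W0))"
      using \<epsilon> W0 by (simp add: ennreal_mult[symmetric] ennreal_plus[symmetric] algebra_simps del: ennreal_plus)
    finally have "(\<integral>\<^sup>+z. ennreal ((cmod (F n z))\<^sup>2) \<partial>\<mu>) \<le> ennreal ?C * ennreal (\<epsilon> * (\<bar>B\<bar> + \<bar>M\<bar> * W0))"
      using nn_integral_le_kernel_integral[OF \<alpha> F fin sets_eq, of n]
      by (meson mult_left_mono order_trans zero_le)
    also have "\<dots> = ennreal (\<epsilon> * (?C * (\<bar>B\<bar> + \<bar>M\<bar> * W0)))"
      using kernel_const_pos[of \<alpha>] \<epsilon> W0 by (simp add: ennreal_mult[symmetric] mult_ac)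
    also have "\<dots> \<le> ennreal (\<epsilon> * D)"
      using \<epsilon> by (intro ennreal_leI mult_left_mono) (auto simp: D_def)
    also have "\<epsilon> * D = e" using D by (simp add: \<epsilon>_def)
    finally show ?case .
  qed
qed

text \<open>Montel's theorem, fed by the bounded point evaluations. Fatou's lemma shows that the
  limit obeys the same norm bound.\<close>

lemma bergman_normal_family:
  fixes F :: "nat \<Rightarrow> complex \<Rightarrow> complex"
  assumes \<alpha>: "\<alpha> > -1" and F: "\<And>n. F n holomorphic_on ball 0 1"
    and B: "\<And>n. bergman_nn \<alpha> (F n) \<le> ennreal B"
  obtains g r where "strict_mono (r :: nat \<Rightarrow> nat)" "g holomorphic_on ball 0 1" "bergman_nn \<alpha> g \<le> ennreal B"
    "\<And>\<rho>. \<rho> < 1 \<Longrightarrow> uniform_limit (cball 0 \<rho>) (\<lambda>n. F (r n)) g sequentially"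
proof -
  define H where "H = {f. f holomorphic_on ball 0 1 \<and> bergman_nn \<alpha> f \<le> ennreal B}"
  have bdd: "\<exists>C. \<forall>f\<in>H. \<forall>z\<in>K. cmod (f z) \<le> C" if K: "compact K" "K \<subseteq> ball 0 1" for K
  proof (cases "K = {}")
    case False
    \<comment> \<open>The evaluation bound grows with \<open>|z|\<close>, so its value at a point of
      largest modulus serves for all of \<open>K\<close>.\<close>
    obtain z0 where z0: "z0 \<in> K" "\<And>z. z \<in> K \<Longrightarrow> cmod z \<le> cmod z0"
      using continuous_attains_sup[OF K(1) False, of cmod] by (auto intro: continuous_intros)
    have z01: "cmod z0 < 1" using z0 K by auto
    define q where "q = kernel_const \<alpha> * (1 - cmod z0) powr - (2 * \<alpha> + 4) * \<bar>B\<bar>"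
    have "cmod (f z) \<le> sqrt q" if "f \<in> H" "z \<in> K" for f z
    proof -
      have z: "cmod z < 1" using that K by auto
      have "ennreal ((cmod (f z))\<^sup>2) \<le> ennreal (kernel_const \<alpha> * (1 - cmod z) powr - (2 * \<alpha> + 4)) * bergman_nn \<alpha> f"
        using that by (intro pointwise_le_bergman_nn \<alpha> z) (auto simp: H_def)
      also have "\<dots> \<le> ennreal (kernel_const \<alpha> * (1 - cmod z0) powr - (2 * \<alpha> + 4)) * ennreal \<bar>B\<bar>"
      proof (intro mult_mono ennreal_leI mult_left_mono)
        show "(1 - cmod z) powr - (2 * \<alpha> + 4) \<le> (1 - cmod z0) powr - (2 * \<alpha> + 4)"
          using \<alpha> z01 z0(2)[OF that(2)] by (intro powr_mono2') auto
        have "bergman_nn \<alpha> f \<le> ennreal B" using that by (simp add: H_def)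
        also have "\<dots> \<le> ennreal \<bar>B\<bar>" by (intro ennreal_leI) auto
        finally show "bergman_nn \<alpha> f \<le> ennreal \<bar>B\<bar>" .
      qed (use kernel_const_pos[of \<alpha>] in auto)
      also have "\<dots> = ennreal q" using kernel_const_pos[of \<alpha>] by (simp add: q_def ennreal_mult)
      finally have "(cmod (f z))\<^sup>2 \<le> q"
        using kernel_const_pos[of \<alpha>] by (subst (asm) ennreal_le_iff) (auto simp: q_def)
      then show ?thesis by (rule real_le_rsqrt)
    qed
    then show ?thesis by blast
  qed auto
  obtain g r where gr: "g holomorphic_on ball 0 1" "strict_mono (r :: nat \<Rightarrow> nat)"
    "\<And>x. x \<in> ball 0 1 \<Longrightarrow> ((\<lambda>n. F (r n) x) \<longlongrightarrow> g x) sequentially"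
    "\<And>K. \<lbrakk>compact K; K \<subseteq> ball 0 1\<rbrakk> \<Longrightarrow> uniform_limit K (F \<circ> r) g sequentially"
    by (rule Montel[of "ball 0 1" H F]) (use bdd F B in \<open>auto simp: H_def\<close>)
  have "bergman_nn \<alpha> g \<le> ennreal B"
  proof -
    define h where "h n u = ennreal ((cmod (F (r n) u))\<^sup>2 * bergman_weight \<alpha> u) * indicator (ball 0 1) u" for n u
    have [measurable]: "h n \<in> borel_measurable lborel" for n
      unfolding h_def using borel_measurable_norm_sq_indicator[OF F borel_measurable_bergman_weight] by simp
    have lim: "ennreal ((cmod (g u))\<^sup>2 * bergman_weight \<alpha> u) * indicator (ball 0 1) u = liminf (\<lambda>n. h n u)" for u
    proof (cases "u \<in> ball 0 1")
      case True
      have "(\<lambda>n. h n u) \<longlonglongrightarrow> ennreal ((cmod (g u))\<^sup>2 * bergman_weight \<alpha> u)"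
        using True unfolding h_def by (auto intro!: tendsto_intros gr(3))
      from lim_imp_Liminf[OF _ this] show ?thesis using True by simp
    qed (simp add: h_def Liminf_const)
    have "bergman_nn \<alpha> g = (\<integral>\<^sup>+u. liminf (\<lambda>n. h n u) \<partial>lborel)"
      unfolding bergman_nn_def lim ..
    also have "\<dots> \<le> liminf (\<lambda>n. integral\<^sup>N lborel (h n))" by (rule nn_integral_liminf) simp
    also have "\<dots> = liminf (\<lambda>n. bergman_nn \<alpha> (F (r n)))" by (simp add: bergman_nn_def h_def[abs_def])
    also have "\<dots> \<le> ennreal B"
      using B by (intro Liminf_le) (auto intro!: always_eventually)
    finally show ?thesis .
  qed
  then show ?thesis
    using gr(1,2) by (intro that[of r g] gr(4)[unfolded o_def]) auto
qed

subsection \<open>Boundedness and compactness through the kernels\<close>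

text \<open>This covers at once the embedding into \<open>L2(\<mu>)\<close> (with \<open>T\<close> the identity, \<open>N = \<mu>\<close>, \<open>d = 1\<close>) and the
  weighted composition operator, whose target norm is an \<open>L2\<close> norm for the weighted area \<open>N\<close>
  up to the normalisation \<open>d = \<pi>\<close>.\<close>

locale bergman_embedding =
  fixes \<alpha> d :: real and \<mu> N :: "complex measure" and Y :: "(complex \<Rightarrow> complex) set"
    and normY :: "(complex \<Rightarrow> complex) \<Rightarrow> real" and T :: "(complex \<Rightarrow> complex) \<Rightarrow> complex \<Rightarrow> complex"
  assumes \<alpha>: "\<alpha> > -1" and d: "d > 0"
    and fin: "finite_measure \<mu>" and sets_\<mu>: "sets \<mu> = sets (restrict_space borel (ball 0 1))"
    and Y_meas: "g \<in> Y \<Longrightarrow> g \<in> borel_measurable N"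
    and Y_diff: "g \<in> Y \<Longrightarrow> g' \<in> Y \<Longrightarrow> (\<lambda>z. g z - g' z) \<in> Y"
    and Y_norm: "g \<in> Y \<Longrightarrow> (\<integral>\<^sup>+z. ennreal ((cmod (g z))\<^sup>2) \<partial>N) = ennreal (d * (normY g)\<^sup>2)"
    and normY_nonneg: "normY g \<ge> 0"
    and T_in: "f \<in> bergman_space \<alpha> \<Longrightarrow> (\<integral>\<^sup>+z. ennreal ((cmod (f z))\<^sup>2) \<partial>\<mu>) < \<infinity> \<Longrightarrow> T f \<in> Y"
    and T_norm: "f \<in> bergman_space \<alpha> \<Longrightarrow>
      (\<integral>\<^sup>+z. ennreal ((cmod (T f z))\<^sup>2) \<partial>N) = (\<integral>\<^sup>+z. ennreal ((cmod (f z))\<^sup>2) \<partial>\<mu>)"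
    and T_add: "T (\<lambda>z. f z + g z) = (\<lambda>z. T f z + T g z)"
    and T_cmult: "T (\<lambda>z. c * f z) = (\<lambda>z. c * T f z)"
    and T_tendsto: "(\<And>z. cmod z < 1 \<Longrightarrow> (\<lambda>n. F n z) \<longlonglongrightarrow> 0) \<Longrightarrow> z \<in> space N \<Longrightarrow> (\<lambda>n. T (F n) z) \<longlonglongrightarrow> 0"
begin

abbreviation K :: "complex \<Rightarrow> ennreal" where "K u \<equiv> (\<integral>\<^sup>+z. ennreal (kernel_sq \<alpha> u z) \<partial>\<mu>)"

text \<open>\<open>K\<close> refers only to \<open>\<mu>\<close>, so operators with the same
  \<open>\<mu>\<close> share it; this equation ties it to the size of \<open>T\<close> on the
  kernels.\<close>

lemma K_eq: "cmod u < 1 \<Longrightarrow> K u = (\<integral>\<^sup>+z. ennreal ((cmod (T (bergman_kernel \<alpha> u) z))\<^sup>2) \<partial>N)"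
  by (simp add: T_norm bergman_kernel_in_space \<alpha> cmod_bergman_kernel_sq)

lemma T_diff: "T (\<lambda>z. f z - g z) = (\<lambda>z. T f z - T g z)"
  using T_add[of f "\<lambda>z. -1 * g z"] T_cmult[of "-1" g] by simp

text \<open>The real content is that \<open>T\<close> maps into \<open>Y\<close>: the bound makes
  the \<mu>-integral of \<open>|f|^2\<close> finite, which is the criterion
  \<open>T_in\<close>.\<close>

lemma linear_of_kernel_bound:
  assumes "\<And>u. cmod u < 1 \<Longrightarrow> K u \<le> ennreal M"
  shows "linear_operator (bergman_space \<alpha>) Y T"
  unfolding linear_operator_def
proof (intro conjI ballI allI T_add T_cmult image_subsetI)
  fix f assume f: "f \<in> bergman_space \<alpha>"
  have "(\<integral>\<^sup>+z. ennreal ((cmod (f z))\<^sup>2) \<partial>\<mu>) \<le> ennreal (kernel_const \<alpha>) * (ennreal M * bergman_nn \<alpha> f)"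
    using f by (intro nn_integral_le_of_kernel_bound \<alpha> fin sets_\<mu> assms) (auto simp: bergman_space_iff)
  also have "\<dots> < \<infinity>" using f by (auto simp: bergman_space_iff ennreal_mult_less_top)
  finally show "T f \<in> Y" by (rule T_in[OF f])
qed

lemma bounded_iff:
  "bounded_operator (bergman_space \<alpha>) (bergman_norm \<alpha>) Y normY T \<longleftrightarrow>
     (\<exists>M. \<forall>u. cmod u < 1 \<longrightarrow> K u \<le> ennreal M)"
proof
  assume "bounded_operator (bergman_space \<alpha>) (bergman_norm \<alpha>) Y normY T"
  then obtain C where lin: "linear_operator (bergman_space \<alpha>) Y T"
    and C: "\<And>f. f \<in> bergman_space \<alpha> \<Longrightarrow> normY (T f) \<le> C * bergman_norm \<alpha> f"
    by (auto simp: bounded_operator_def)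
  show "\<exists>M. \<forall>u. cmod u < 1 \<longrightarrow> K u \<le> ennreal M"
  proof (intro exI allI impI)
    fix u :: complex assume u: "cmod u < 1"
    let ?k = "bergman_kernel \<alpha> u"
    have k: "?k \<in> bergman_space \<alpha>" using \<alpha> u by (rule bergman_kernel_in_space)
    then have Tk: "T ?k \<in> Y" using lin by (auto simp: linear_operator_def)
    have "ennreal (pi * (bergman_norm \<alpha> ?k)\<^sup>2) = bergman_nn \<alpha> (\<lambda>_. 1)"
      using bergman_nn_eq_norm[OF k] bergman_nn_bergman_kernel[OF \<alpha> u] by simp
    then have nk: "pi * (bergman_norm \<alpha> ?k)\<^sup>2 = enn2real (bergman_nn \<alpha> (\<lambda>_. 1))"
      by (metis enn2real_ennreal mult_nonneg_nonneg pi_ge_zero zero_le_power2)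
    have "K u = ennreal (d * (normY (T ?k))\<^sup>2)" using K_eq[OF u] Y_norm[OF Tk] by simp
    also have "\<dots> \<le> ennreal (d * (C * bergman_norm \<alpha> ?k)\<^sup>2)"
      using d C[OF k] normY_nonneg by (intro ennreal_leI mult_left_mono power_mono) auto
    also have "d * (C * bergman_norm \<alpha> ?k)\<^sup>2 = d * C\<^sup>2 / pi * enn2real (bergman_nn \<alpha> (\<lambda>_. 1))"
      unfolding nk[symmetric] by (simp add: power_mult_distrib)
    finally show "K u \<le> ennreal (d * C\<^sup>2 / pi * enn2real (bergman_nn \<alpha> (\<lambda>_. 1)))" .
  qed
next
  assume "\<exists>M. \<forall>u. cmod u < 1 \<longrightarrow> K u \<le> ennreal M"
  then obtain M0 where M0: "\<And>u. cmod u < 1 \<Longrightarrow> K u \<le> ennreal M0" by blast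
  \<comment> \<open>\<open>ennreal\<close> sends negative reals to 0, so \<open>M0\<close> could be
    negative; the absolute value is still a bound and may stand under the square root below.\<close>
  define M where "M = \<bar>M0\<bar>"
  have M: "\<And>u. cmod u < 1 \<Longrightarrow> K u \<le> ennreal M" "M \<ge> 0"
    unfolding M_def by (auto intro: order_trans[OF M0] ennreal_leI)
  have lin: "linear_operator (bergman_space \<alpha>) Y T" using M(1) by (rule linear_of_kernel_bound)
  let ?C = "sqrt (kernel_const \<alpha> * M * pi / d)"
  have q: "0 \<le> kernel_const \<alpha> * M * pi / d"
    by (intro divide_nonneg_pos mult_nonneg_nonneg less_imp_le[OF kernel_const_pos] M d pi_ge_zero)
  have "normY (T f) \<le> ?C * bergman_norm \<alpha> f" if f: "f \<in> bergman_space \<alpha>" for f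
  proof -
    have Tf: "T f \<in> Y" using lin f by (auto simp: linear_operator_def)
    have "ennreal (d * (normY (T f))\<^sup>2) = (\<integral>\<^sup>+z. ennreal ((cmod (f z))\<^sup>2) \<partial>\<mu>)"
      using Y_norm[OF Tf] T_norm[OF f] by simp
    also have "\<dots> \<le> ennreal (kernel_const \<alpha>) * (ennreal M * bergman_nn \<alpha> f)"
      using f by (intro nn_integral_le_of_kernel_bound \<alpha> fin sets_\<mu> M(1)) (auto simp: bergman_space_iff)
    also have "\<dots> = ennreal (kernel_const \<alpha> * (M * (pi * (bergman_norm \<alpha> f)\<^sup>2)))"
      using M(2) kernel_const_pos[of \<alpha>] by (simp add: bergman_nn_eq_norm[OF f] ennreal_mult)
    finally have "d * (normY (T f))\<^sup>2 \<le> kernel_const \<alpha> * (M * (pi * (bergman_norm \<alpha> f)\<^sup>2))"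
      using M(2) kernel_const_pos[of \<alpha>] by (subst (asm) ennreal_le_iff) auto
    then have "(normY (T f))\<^sup>2 \<le> kernel_const \<alpha> * (M * (pi * (bergman_norm \<alpha> f)\<^sup>2)) / d"
      by (subst pos_le_divide_eq[OF d]) (simp only: mult.commute[of _ d])
    also have "\<dots> = kernel_const \<alpha> * M * pi / d * (bergman_norm \<alpha> f)\<^sup>2" by simp
    also have "kernel_const \<alpha> * M * pi / d = ?C\<^sup>2"
      by (rule real_sqrt_pow2[symmetric, OF q])
    also have "?C\<^sup>2 * (bergman_norm \<alpha> f)\<^sup>2 = (?C * bergman_norm \<alpha> f)\<^sup>2"
      by (rule power_mult_distrib[symmetric])
    finally have "(normY (T f))\<^sup>2 \<le> (?C * bergman_norm \<alpha> f)\<^sup>2" .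
    then show ?thesis
      by (rule power2_le_imp_le) (intro mult_nonneg_nonneg bergman_norm_nonneg real_sqrt_ge_zero q)
  qed
  with lin show "bounded_operator (bergman_space \<alpha>) (bergman_norm \<alpha>) Y normY T"
    unfolding bounded_operator_def by blast
qed

text \<open>Away from the circle the kernels are uniformly bounded, so finiteness of
  \<open>\<mu>\<close> alone bounds \<open>K\<close>.\<close>

lemma K_le:
  assumes "cmod u \<le> \<rho>" "\<rho> < 1"
  shows "K u \<le> ennreal ((1 - \<rho>) powr - (2 * \<alpha> + 4) * measure \<mu> (space \<mu>))"
proof -
  interpret finite_measure \<mu> by (rule fin)
  have space: "space \<mu> = ball 0 1"
    using sets_eq_imp_space_eq[OF sets_\<mu>] by (simp add: space_restrict_space)
  let ?q = "(1 - \<rho>) powr - (2 * \<alpha> + 4)"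
  have "K u \<le> (\<integral>\<^sup>+z. ennreal ?q \<partial>\<mu>)"
  proof (intro nn_integral_mono ennreal_leI)
    fix z assume "z \<in> space \<mu>"
    then have "kernel_sq \<alpha> u z \<le> (1 - cmod u) powr - (2 * \<alpha> + 4)"
      using \<alpha> assms by (intro kernel_sq_le') (auto simp: space)
    also have "\<dots> \<le> ?q" using \<alpha> assms by (intro powr_mono2') auto
    finally show "kernel_sq \<alpha> u z \<le> ?q" .
  qed
  also have "\<dots> = ennreal (?q * measure \<mu> (space \<mu>))"
    by (simp add: emeasure_eq_measure ennreal_mult)
  finally show ?thesis .
qed

lemma K_finite: "cmod u < 1 \<Longrightarrow> K u < \<infinity>"
  using K_le[of u "cmod u"] by (auto intro: le_less_trans)

text \<open>\<open>K\<close> is at most 1 near the circle and bounded inside by \<open>K_le\<close>.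
  The vanishing condition thus already guarantees that \<open>T\<close> maps into \<open>Y\<close>,
  which is part of compactness.\<close>

lemma kernel_bound_of_vanishing:
  assumes "\<And>e. e > 0 \<Longrightarrow> \<exists>\<rho><1. \<forall>u. \<rho> < cmod u \<and> cmod u < 1 \<longrightarrow> K u \<le> ennreal e"
  shows "\<exists>M. \<forall>u. cmod u < 1 \<longrightarrow> K u \<le> ennreal M"
proof -
  obtain \<rho> where \<rho>: "\<rho> < 1" "\<And>u. \<rho> < cmod u \<Longrightarrow> cmod u < 1 \<Longrightarrow> K u \<le> ennreal 1"
    using assms[of 1] by auto
  let ?M = "(1 - \<rho>) powr - (2 * \<alpha> + 4) * measure \<mu> (space \<mu>)"
  have "K u \<le> ennreal (max 1 ?M)" if "cmod u < 1" for u
  proof (cases "\<rho> < cmod u")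
    case True
    then show ?thesis
      by (rule order_trans[OF \<rho>(2)[OF _ that]]) (auto intro: ennreal_leI)
  next
    case False
    then have "K u \<le> ennreal ?M" using \<rho>(1) by (intro K_le) auto
    then show ?thesis by (rule order_trans) (auto intro: ennreal_leI)
  qed
  then show ?thesis by blast
qed

text \<open>Otherwise there are points tending to the circle with \<open>K > e\<close>. Their
  kernels form a bounded sequence, so some subsequence of images converges in \<open>Y\<close>; the
  images also tend to 0 pointwise, so the limit is null and \<open>K\<close> tends to 0 along the
  subsequence, a contradiction.\<close>

lemma vanishing_of_compact:
  assumes comp: "compact_operator (bergman_space \<alpha>) (bergman_norm \<alpha>) Y normY T" and "e > 0"
  shows "\<exists>\<rho><1. \<forall>u. \<rho> < cmod u \<and> cmod u < 1 \<longrightarrow> K u \<le> ennreal e"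
proof (rule ccontr)
  assume "\<not> ?thesis"
  then have "\<exists>u. \<rho> < cmod u \<and> cmod u < 1 \<and> K u > ennreal e" if "\<rho> < 1" for \<rho>
    using that by (meson not_le)
  then have "\<exists>u. 1 - 1 / real (Suc n) < cmod u \<and> cmod u < 1 \<and> K u > ennreal e" for n
    by simp
  then obtain u where u: "\<And>n. 1 - 1 / real (Suc n) < cmod (u n)" "\<And>n. cmod (u n) < 1" "\<And>n. K (u n) > ennreal e"
    by metis
  have u_lim: "(\<lambda>n. cmod (u n)) \<longlonglongrightarrow> 1"
  proof (rule tendsto_sandwich[OF _ _ _ tendsto_const])
    show "(\<lambda>n. 1 - 1 / real (Suc n)) \<longlonglongrightarrow> 1"
      using tendsto_diff[OF tendsto_const[of 1] LIMSEQ_inverse_real_of_nat] by (simp add: field_simps inverse_eq_divide)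
  qed (use u in \<open>auto intro!: always_eventually less_imp_le\<close>)
  let ?F = "\<lambda>n. bergman_kernel \<alpha> (u n)"
  have F: "?F n \<in> bergman_space \<alpha>" for n using \<alpha> u(2) by (rule bergman_kernel_in_space)
  have "bergman_norm \<alpha> (?F n) = sqrt (enn2real (bergman_nn \<alpha> (\<lambda>_. 1)) / pi)" for n
  proof -
    have "ennreal (pi * (bergman_norm \<alpha> (?F n))\<^sup>2) = bergman_nn \<alpha> (\<lambda>_. 1)"
      using bergman_nn_eq_norm[OF F] bergman_nn_bergman_kernel[OF \<alpha> u(2)] by simp
    then have "pi * (bergman_norm \<alpha> (?F n))\<^sup>2 = enn2real (bergman_nn \<alpha> (\<lambda>_. 1))"
      by (metis enn2real_ennreal mult_nonneg_nonneg pi_ge_zero zero_le_power2)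
    then have "(bergman_norm \<alpha> (?F n))\<^sup>2 = enn2real (bergman_nn \<alpha> (\<lambda>_. 1)) / pi" by (simp add: field_simps)
    then show ?thesis using bergman_norm_nonneg by (metis real_sqrt_unique)
  qed
  then have "bdd_above (range (\<lambda>n. bergman_norm \<alpha> (?F n)))" by simp
  moreover have "range ?F \<subseteq> bergman_space \<alpha>" using F by auto
  ultimately obtain r g where r: "strict_mono r" and g: "g \<in> Y"
    and lim: "(\<lambda>n. normY (\<lambda>z. T (?F (r n)) z - g z)) \<longlonglongrightarrow> 0"
    using comp[unfolded compact_operator_def, THEN conjunct2, rule_format, of ?F] by blast
  have lin: "T ` bergman_space \<alpha> \<subseteq> Y" using comp by (simp add: compact_operator_def linear_operator_def)
  define a where "a n = (\<integral>\<^sup>+z. ennreal ((cmod (T (?F (r n)) z - g z))\<^sup>2) \<partial>N)" for n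
  have TF: "T (?F n) \<in> Y" for n using lin F by auto
  have a_eq: "a n = ennreal (d * (normY (\<lambda>z. T (?F (r n)) z - g z))\<^sup>2)" for n
    unfolding a_def by (rule Y_norm[OF Y_diff[OF TF g]])
  have a_lim: "a \<longlonglongrightarrow> 0"
  proof -
    have "(\<lambda>n. ennreal (d * (normY (\<lambda>z. T (?F (r n)) z - g z))\<^sup>2)) \<longlonglongrightarrow> ennreal (d * 0\<^sup>2)"
      by (intro tendsto_intros lim)
    then show ?thesis by (simp add: a_eq[abs_def])
  qed
  have [measurable]: "g \<in> borel_measurable N" "T (?F n) \<in> borel_measurable N" for n
    using Y_meas g TF by auto
  have pt: "(\<lambda>n. T (?F (r n)) z) \<longlonglongrightarrow> 0" if "z \<in> space N" for z
  proof (rule T_tendsto[OF _ that])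
    fix z :: complex assume "cmod z < 1"
    then have "(\<lambda>n. ?F n z) \<longlonglongrightarrow> 0" by (rule tendsto_bergman_kernel_0[OF \<alpha> u(2) u_lim])
    then show "(\<lambda>n. ?F (r n) z) \<longlonglongrightarrow> 0" using LIMSEQ_subseq_LIMSEQ[OF _ r] by (simp add: o_def)
  qed
  \<comment> \<open>The norm limit \<open>g\<close> has seminorm 0 by Fatou, because \<open>T (F n)\<close> tends to 0 pointwise.\<close>
  have "(\<integral>\<^sup>+z. ennreal ((cmod (g z))\<^sup>2) \<partial>N) = (\<integral>\<^sup>+z. liminf (\<lambda>n. ennreal ((cmod (T (?F (r n)) z - g z))\<^sup>2)) \<partial>N)"
  proof (rule nn_integral_cong)
    fix z assume "z \<in> space N"
    then have "(\<lambda>n. ennreal ((cmod (T (?F (r n)) z - g z))\<^sup>2)) \<longlonglongrightarrow> ennreal ((cmod (0 - g z))\<^sup>2)"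
      by (intro tendsto_intros pt)
    from lim_imp_Liminf[OF _ this] show "ennreal ((cmod (g z))\<^sup>2) = liminf (\<lambda>n. ennreal ((cmod (T (?F (r n)) z - g z))\<^sup>2))"
      by simp
  qed
  also have "\<dots> \<le> liminf a"
    unfolding a_def by (rule nn_integral_liminf) measurable
  also have "\<dots> = 0" using lim_imp_Liminf[OF _ a_lim] by simp
  finally have g0: "(\<integral>\<^sup>+z. ennreal ((cmod (g z))\<^sup>2) \<partial>N) = 0" by simp
  have K_le: "K (u (r n)) \<le> 2 * a n" for n
  proof -
    have "K (u (r n)) = (\<integral>\<^sup>+z. ennreal ((cmod (T (?F (r n)) z))\<^sup>2) \<partial>N)" by (rule K_eq[OF u(2)])
    also have "\<dots> \<le> (\<integral>\<^sup>+z. 2 * ennreal ((cmod (T (?F (r n)) z - g z))\<^sup>2) + 2 * ennreal ((cmod (g z))\<^sup>2) \<partial>N)"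
    proof (rule nn_integral_mono)
      fix z
      have "ennreal ((cmod (T (?F (r n)) z))\<^sup>2) \<le> ennreal (2 * (cmod (T (?F (r n)) z - g z))\<^sup>2 + 2 * (cmod (g z))\<^sup>2)"
        using norm_add_sq_le[of "T (?F (r n)) z - g z" "g z"] by (intro ennreal_leI) simp
      also have "\<dots> = 2 * ennreal ((cmod (T (?F (r n)) z - g z))\<^sup>2) + 2 * ennreal ((cmod (g z))\<^sup>2)"
        by (simp add: ennreal_mult)
      finally show "ennreal ((cmod (T (?F (r n)) z))\<^sup>2) \<le> \<dots>" .
    qed
    also have "\<dots> = 2 * a n"
      by (simp add: nn_integral_add nn_integral_cmult a_def g0)
    finally show ?thesis .
  qed
  have "(\<lambda>n. 2 * a n) \<longlonglongrightarrow> 2 * 0" by (intro tendsto_intros a_lim ennreal_tendsto_cmult) auto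
  then have "\<forall>\<^sub>F n in sequentially. 2 * a n < ennreal e"
    using \<open>e > 0\<close> by (intro order_tendstoD(2)) auto
  then obtain n where "2 * a n < ennreal e" by (metis eventually_happens sequentially_bot)
  with K_le[of n] u(3)[of "r n"] show False by (meson leD less_trans order_le_less_trans)
qed

text \<open>The limit of the images is \<open>T g\<close> for a normal-family limit \<open>g\<close>
  that stays in the space. The differences from \<open>g\<close> have bounded norms and tend to 0
  locally uniformly, so the split at a radius applies to them.\<close>

lemma compact_of_vanishing:
  assumes van: "\<And>e. e > 0 \<Longrightarrow> \<exists>\<rho><1. \<forall>u. \<rho> < cmod u \<and> cmod u < 1 \<longrightarrow> K u \<le> ennreal e"
  shows "compact_operator (bergman_space \<alpha>) (bergman_norm \<alpha>) Y normY T"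
proof -
  obtain M where M: "\<And>u. cmod u < 1 \<Longrightarrow> K u \<le> ennreal M"
    using kernel_bound_of_vanishing[OF van] by blast
  have lin: "linear_operator (bergman_space \<alpha>) Y T" using M by (rule linear_of_kernel_bound)
  then have TY: "T f \<in> Y" if "f \<in> bergman_space \<alpha>" for f using that by (auto simp: linear_operator_def)
  have "\<exists>r g. strict_mono r \<and> g \<in> Y \<and> (\<lambda>n. normY (\<lambda>z. T (F (r n)) z - g z)) \<longlonglongrightarrow> 0"
    if F: "range F \<subseteq> bergman_space \<alpha>" "bdd_above (range (\<lambda>n. bergman_norm \<alpha> (F n)))" for F :: "nat \<Rightarrow> complex \<Rightarrow> complex"
  proof -
    have FA: "F n \<in> bergman_space \<alpha>" for n using F(1) by auto
    obtain b where b: "\<And>n. bergman_norm \<alpha> (F n) \<le> b" using F(2) by (auto simp: bdd_above_def)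
    define B where "B = pi * b\<^sup>2"
    have B: "bergman_nn \<alpha> (F n) \<le> ennreal B" for n
      unfolding bergman_nn_eq_norm[OF FA] B_def
      by (intro ennreal_leI mult_left_mono power_mono b bergman_norm_nonneg) auto
    have Fh: "F n holomorphic_on ball 0 1" for n using FA by (auto simp: bergman_space_iff)
    obtain g r where r: "strict_mono (r :: nat \<Rightarrow> nat)" and g: "g holomorphic_on ball 0 1" "bergman_nn \<alpha> g \<le> ennreal B"
      and unif: "\<And>\<rho>. \<rho> < 1 \<Longrightarrow> uniform_limit (cball 0 \<rho>) (\<lambda>n. F (r n)) g sequentially"
      by (rule bergman_normal_family[where F = F, OF \<alpha> Fh B]) (rule that)
    have gA: "g \<in> bergman_space \<alpha>" using g by (auto simp: bergman_space_iff intro: le_less_trans)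
    define G where "G n = (\<lambda>z. F (r n) z - g z)" for n
    have GA: "G n \<in> bergman_space \<alpha>" for n unfolding G_def by (intro bergman_space_diff FA gA)
    have Gh: "G n holomorphic_on ball 0 1" for n using GA by (auto simp: bergman_space_iff)
    have B0: "B \<ge> 0" by (simp add: B_def)
    have GB: "bergman_nn \<alpha> (G n) \<le> ennreal (4 * B)" for n
    proof -
      have "bergman_nn \<alpha> (G n) \<le> 2 * bergman_nn \<alpha> (F (r n)) + 2 * bergman_nn \<alpha> g"
        unfolding G_def by (intro bergman_nn_diff_le Fh g)
      also have "\<dots> \<le> 2 * ennreal B + 2 * ennreal B"
        by (intro add_mono mult_left_mono B g) auto
      also have "\<dots> = ennreal (4 * B)" using B0 by (simp add: ennreal_mult flip: distrib_right)
      finally show ?thesis .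
    qed
    have Gu: "uniform_limit (cball 0 \<rho>) G (\<lambda>_. 0) sequentially" if "\<rho> < 1" for \<rho>
      using unif[OF that] unfolding uniform_limit_iff G_def by (simp add: dist_norm)
    have "(\<lambda>n. normY (T (G n))) \<longlonglongrightarrow> 0"
    proof (rule tendstoI)
      fix e :: real assume "e > 0"
      \<comment> \<open>Halving turns the non-strict estimate into the strict one that the limit
        requires.\<close>
      then have "d * e\<^sup>2 / 2 > 0" using d by simp
      then have "\<forall>\<^sub>F n in sequentially. (\<integral>\<^sup>+z. ennreal ((cmod (G n z))\<^sup>2) \<partial>\<mu>) \<le> ennreal (d * e\<^sup>2 / 2)"
        by (intro eventually_nn_integral_le_of_vanishing[OF \<alpha> Gh GB Gu fin sets_\<mu> M van])
      then show "\<forall>\<^sub>F n in sequentially. dist (normY (T (G n))) 0 < e"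
      proof eventually_elim
        case (elim n)
        have "ennreal (d * (normY (T (G n)))\<^sup>2) \<le> ennreal (d * e\<^sup>2 / 2)"
          using elim Y_norm[OF TY[OF GA]] T_norm[OF GA] by metis
        then have "d * (normY (T (G n)))\<^sup>2 \<le> d * e\<^sup>2 / 2"
          using d by (subst (asm) ennreal_le_iff) auto
        then have "(normY (T (G n)))\<^sup>2 \<le> e\<^sup>2 / 2" using d by (simp add: field_simps)
        also have "\<dots> < e\<^sup>2" using \<open>e > 0\<close> by simp
        finally have "normY (T (G n)) < e" using \<open>e > 0\<close> by (simp add: power2_less_imp_less)
        then show ?case using normY_nonneg by simp
      qed
    qed
    then have "(\<lambda>n. normY (\<lambda>z. T (F (r n)) z - T g z)) \<longlonglongrightarrow> 0" by (simp add: G_def T_diff)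
    with r TY[OF gA] show ?thesis by blast
  qed
  with lin show ?thesis unfolding compact_operator_def by blast
qed

lemma compact_iff:
  "compact_operator (bergman_space \<alpha>) (bergman_norm \<alpha>) Y normY T \<longleftrightarrow>
     (\<forall>e>0. \<exists>\<rho><1. \<forall>u. \<rho> < cmod u \<and> cmod u < 1 \<longrightarrow> K u \<le> ennreal e)"
  using vanishing_of_compact compact_of_vanishing by blast

end

subsection \<open>The pullback measure\<close>

lemma measurable_restrict_lborel_ball:
  "f holomorphic_on ball 0 1 \<Longrightarrow> f \<in> borel_measurable (restrict_space lborel (ball 0 1))"
  using borel_measurable_continuous_on_restrict[OF holomorphic_on_imp_continuous_on, of f "ball 0 1"]
  by (simp cong: measurable_cong_sets add: sets_restrict_space)

lemma measurable_self_map: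
  assumes "\<phi> holomorphic_on ball 0 1" "\<phi> ` ball 0 1 \<subseteq> ball 0 1"
  shows "\<phi> \<in> restrict_space lborel (ball 0 1) \<rightarrow>\<^sub>M restrict_space borel (ball 0 1)"
  using assms by (intro measurable_restrict_space2 measurable_restrict_lborel_ball)
    (auto simp: space_restrict_space)

lemma borel_measurable_weight_restrict:
  "bergman_weight \<alpha> \<in> borel_measurable (restrict_space lborel (ball 0 1))"
  by (intro measurable_restrict_space1) simp

lemma sets_pullback_measure:
  "sets (pullback_measure \<alpha> h \<phi>) = sets (restrict_space borel (ball 0 1))"
  by (simp add: pullback_measure_def)

lemma nn_integral_pullback_measure:
  assumes \<phi>: "\<phi> holomorphic_on ball 0 1" "\<phi> ` ball 0 1 \<subseteq> ball 0 1" and h: "h holomorphic_on ball 0 1"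
    and g: "g \<in> borel_measurable (restrict_space borel (ball 0 1))"
  shows "(\<integral>\<^sup>+z. g z \<partial>pullback_measure \<alpha> h \<phi>) =
    (\<integral>\<^sup>+z\<in>ball 0 1. ennreal ((cmod (h z))\<^sup>2 * bergman_weight \<alpha> z) * g (\<phi> z) \<partial>lborel)"
proof -
  note [measurable] = measurable_self_map[OF \<phi>] measurable_restrict_lborel_ball[OF h]
    borel_measurable_weight_restrict[of \<alpha>] g
  have "(\<lambda>z. g (\<phi> z)) \<in> borel_measurable (restrict_space lborel (ball 0 1))"
    using measurable_compose[OF measurable_self_map[OF \<phi>] g] .
  note [measurable] = this
  have "(\<integral>\<^sup>+z. g z \<partial>pullback_measure \<alpha> h \<phi>) =
    (\<integral>\<^sup>+z. ennreal ((cmod (h z))\<^sup>2 * bergman_weight \<alpha> z) * g (\<phi> z) \<partial>restrict_space lborel (ball 0 1))"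
    unfolding pullback_measure_def
    by (subst nn_integral_distr) (simp_all add: nn_integral_density)
  also have "\<dots> = (\<integral>\<^sup>+z\<in>ball 0 1. ennreal ((cmod (h z))\<^sup>2 * bergman_weight \<alpha> z) * g (\<phi> z) \<partial>lborel)"
    by (subst nn_integral_restrict_space) auto
  finally show ?thesis .
qed

text \<open>The link between the two operators: up to the normalisation \<pi>, the weighted
  composition operator and the embedding give every \<open>f\<close> the same norm.\<close>

lemma nn_integral_pullback_measure_sq:
  assumes \<phi>: "\<phi> holomorphic_on ball 0 1" "\<phi> ` ball 0 1 \<subseteq> ball 0 1" and h: "h holomorphic_on ball 0 1"
    and f: "f holomorphic_on ball 0 1"
  shows "(\<integral>\<^sup>+z. ennreal ((cmod (f z))\<^sup>2) \<partial>pullback_measure \<alpha> h \<phi>) = bergman_nn \<alpha> (weighted_comp h \<phi> f)"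
proof -
  have "f \<in> borel_measurable (restrict_space borel (ball 0 1))"
    using f by (intro borel_measurable_continuous_on_restrict holomorphic_on_imp_continuous_on)
  then show ?thesis
    using \<phi> h unfolding bergman_nn_def weighted_comp_def
    by (subst nn_integral_pullback_measure)
      (auto intro!: nn_integral_cong simp: ennreal_mult[symmetric] norm_mult power_mult_distrib mult_ac)
qed

text \<open>The total mass is the integral of the constant 1, hence the squared norm of
  \<open>h\<close> up to the factor \<pi>.\<close>

lemma finite_measure_pullback_measure:
  assumes \<phi>: "\<phi> holomorphic_on ball 0 1" "\<phi> ` ball 0 1 \<subseteq> ball 0 1" and h: "h \<in> bergman_space \<alpha>"
  shows "finite_measure (pullback_measure \<alpha> h \<phi>)"
proof
  have "emeasure (pullback_measure \<alpha> h \<phi>) (space (pullback_measure \<alpha> h \<phi>)) =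
    (\<integral>\<^sup>+z. ennreal ((cmod 1)\<^sup>2) \<partial>pullback_measure \<alpha> h \<phi>)" by simp
  also have "\<dots> = bergman_nn \<alpha> (weighted_comp h \<phi> (\<lambda>_. 1))"
    using \<phi> h by (intro nn_integral_pullback_measure_sq) (auto simp: bergman_space_iff)
  also have "\<dots> < \<infinity>" using h by (simp add: weighted_comp_def bergman_space_iff)
  finally show "emeasure (pullback_measure \<alpha> h \<phi>) (space (pullback_measure \<alpha> h \<phi>)) \<noteq> \<infinity>" by simp
qed

lemma weighted_comp_holomorphic:
  assumes "\<phi> holomorphic_on ball 0 1" "\<phi> ` ball 0 1 \<subseteq> ball 0 1" "h holomorphic_on ball 0 1" "f holomorphic_on ball 0 1"
  shows "weighted_comp h \<phi> f holomorphic_on ball 0 1"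
  using holomorphic_on_compose_gen[OF assms(1,4,2)] assms(3)
  unfolding weighted_comp_def by (auto intro!: holomorphic_intros simp: o_def)

lemma embedding_Carleson:
  assumes "\<alpha> > -1" and \<phi>: "\<phi> holomorphic_on ball 0 1" "\<phi> ` ball 0 1 \<subseteq> ball 0 1" and h: "h \<in> bergman_space \<alpha>"
  shows "bergman_embedding \<alpha> 1 (pullback_measure \<alpha> h \<phi>) (pullback_measure \<alpha> h \<phi>)
    (L2_space (pullback_measure \<alpha> h \<phi>)) (L2_norm (pullback_measure \<alpha> h \<phi>)) (\<lambda>f. f)"
proof -
  define \<mu> where "\<mu> = pullback_measure \<alpha> h \<phi>"
  note sets = sets_pullback_measure[of \<alpha> h \<phi>, folded \<mu>_def]
  have space: "space \<mu> = ball 0 1"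
    using sets_eq_imp_space_eq[OF sets] by (simp add: space_restrict_space)
  have meas: "f \<in> borel_measurable \<mu>" if "f \<in> bergman_space \<alpha>" for f
  proof -
    have "f \<in> borel_measurable (restrict_space borel (ball 0 1))"
      using that by (intro borel_measurable_continuous_on_restrict holomorphic_on_imp_continuous_on)
        (auto simp: bergman_space_iff)
    then show ?thesis by (simp cong: measurable_cong_sets add: sets)
  qed
  have "bergman_embedding \<alpha> 1 \<mu> \<mu> (L2_space \<mu>) (L2_norm \<mu>) (\<lambda>f. f)"
  proof (rule bergman_embedding.intro)
    show "finite_measure \<mu>" unfolding \<mu>_def using \<phi> h by (rule finite_measure_pullback_measure)
    show "sets \<mu> = sets (restrict_space borel (ball 0 1))" by (rule sets)
    show "g \<in> borel_measurable \<mu>" if "g \<in> L2_space \<mu>" for g using that by (simp add: L2_space_def)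
    show "(\<lambda>z. g z - g' z) \<in> L2_space \<mu>" if gg: "g \<in> L2_space \<mu>" "g' \<in> L2_space \<mu>" for g g'
    proof -
      have [measurable]: "g \<in> borel_measurable \<mu>" "g' \<in> borel_measurable \<mu>" using gg by (auto simp: L2_space_def)
      have "integrable \<mu> (\<lambda>z. 2 * (cmod (g z))\<^sup>2 + 2 * (cmod (g' z))\<^sup>2)"
        using gg by (auto simp: L2_space_def)
      then have "integrable \<mu> (\<lambda>z. (cmod (g z - g' z))\<^sup>2)"
      proof (rule Bochner_Integration.integrable_bound)
        show "AE z in \<mu>. norm ((cmod (g z - g' z))\<^sup>2) \<le> norm (2 * (cmod (g z))\<^sup>2 + 2 * (cmod (g' z))\<^sup>2)"
          using norm_add_sq_le[of "g _" "- g' _"] by (auto intro!: AE_I2)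
      qed measurable
      then show ?thesis by (simp add: L2_space_def)
    qed
    show "(\<integral>\<^sup>+z. ennreal ((cmod (g z))\<^sup>2) \<partial>\<mu>) = ennreal (1 * (L2_norm \<mu> g)\<^sup>2)" if "g \<in> L2_space \<mu>" for g
      using that by (subst nn_integral_eq_integral) (auto simp: L2_space_def L2_norm_def)
    show "0 \<le> L2_norm \<mu> g" for g by (simp add: L2_norm_def)
    show "f \<in> L2_space \<mu>" if "f \<in> bergman_space \<alpha>" "(\<integral>\<^sup>+z. ennreal ((cmod (f z))\<^sup>2) \<partial>\<mu>) < \<infinity>" for f
      using meas[OF that(1)] that(2) by (auto simp: L2_space_def intro!: integrableI_nonneg)
  qed (use assms in \<open>auto simp: space\<close>)
  then show ?thesis by (simp only: \<mu>_def)
qed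

lemma embedding_weighted_comp:
  assumes "\<alpha> > -1" and \<phi>: "\<phi> holomorphic_on ball 0 1" "\<phi> ` ball 0 1 \<subseteq> ball 0 1" and h: "h \<in> bergman_space \<alpha>"
  shows "bergman_embedding \<alpha> pi (pullback_measure \<alpha> h \<phi>)
    (density (restrict_space lborel (ball 0 1)) (\<lambda>z. ennreal (bergman_weight \<alpha> z)))
    (bergman_space \<alpha>) (bergman_norm \<alpha>) (weighted_comp h \<phi>)"
proof -
  let ?N = "density (restrict_space lborel (ball 0 1)) (\<lambda>z. ennreal (bergman_weight \<alpha> z))"
  have hh: "h holomorphic_on ball 0 1" using h by (simp add: bergman_space_iff)
  have meas: "g \<in> borel_measurable ?N" if "g holomorphic_on ball 0 1" for g
    using measurable_restrict_lborel_ball[OF that] by simp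
  have N: "(\<integral>\<^sup>+z. ennreal ((cmod (g z))\<^sup>2) \<partial>?N) = bergman_nn \<alpha> g" if g: "g holomorphic_on ball 0 1" for g
  proof -
    note [measurable] = measurable_restrict_lborel_ball[OF g] borel_measurable_weight_restrict[of \<alpha>]
    have "(\<integral>\<^sup>+z. ennreal ((cmod (g z))\<^sup>2) \<partial>?N) =
      (\<integral>\<^sup>+z. ennreal (bergman_weight \<alpha> z) * ennreal ((cmod (g z))\<^sup>2) \<partial>restrict_space lborel (ball 0 1))"
      by (rule nn_integral_density) measurable
    also have "\<dots> = bergman_nn \<alpha> g"
      unfolding bergman_nn_def
      by (subst nn_integral_restrict_space) (auto simp: ennreal_mult[symmetric] mult.commute)
    finally show ?thesis .
  qed
  have W: "weighted_comp h \<phi> f holomorphic_on ball 0 1" if "f \<in> bergman_space \<alpha>" for f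
    using that \<phi> hh by (intro weighted_comp_holomorphic) (auto simp: bergman_space_iff)
  have P: "(\<integral>\<^sup>+z. ennreal ((cmod (f z))\<^sup>2) \<partial>pullback_measure \<alpha> h \<phi>) = bergman_nn \<alpha> (weighted_comp h \<phi> f)"
    if "f \<in> bergman_space \<alpha>" for f
    using that \<phi> hh by (intro nn_integral_pullback_measure_sq) (auto simp: bergman_space_iff)
  show ?thesis
  proof (rule bergman_embedding.intro)
    show "finite_measure (pullback_measure \<alpha> h \<phi>)" using \<phi> h by (rule finite_measure_pullback_measure)
    show "sets (pullback_measure \<alpha> h \<phi>) = sets (restrict_space borel (ball 0 1))" by (rule sets_pullback_measure)
    show "g \<in> borel_measurable ?N" if "g \<in> bergman_space \<alpha>" for g
      using that by (intro meas) (simp add: bergman_space_iff)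
    show "(\<lambda>z. g z - g' z) \<in> bergman_space \<alpha>" if "g \<in> bergman_space \<alpha>" "g' \<in> bergman_space \<alpha>" for g g'
      using that by (rule bergman_space_diff)
    show "(\<integral>\<^sup>+z. ennreal ((cmod (g z))\<^sup>2) \<partial>?N) = ennreal (pi * (bergman_norm \<alpha> g)\<^sup>2)" if "g \<in> bergman_space \<alpha>" for g
      using that by (simp add: N bergman_nn_eq_norm[symmetric] bergman_space_iff)
    show "0 \<le> bergman_norm \<alpha> g" for g by (rule bergman_norm_nonneg)
    show "weighted_comp h \<phi> f \<in> bergman_space \<alpha>"
      if "f \<in> bergman_space \<alpha>" "(\<integral>\<^sup>+z. ennreal ((cmod (f z))\<^sup>2) \<partial>pullback_measure \<alpha> h \<phi>) < \<infinity>" for f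
      using that by (simp add: P W bergman_space_iff[of "weighted_comp h \<phi> f"])
    show "(\<integral>\<^sup>+z. ennreal ((cmod (weighted_comp h \<phi> f z))\<^sup>2) \<partial>?N) =
      (\<integral>\<^sup>+z. ennreal ((cmod (f z))\<^sup>2) \<partial>pullback_measure \<alpha> h \<phi>)" if "f \<in> bergman_space \<alpha>" for f
      using that by (simp add: N W P)
    show "(\<lambda>n. weighted_comp h \<phi> (F n) z) \<longlonglongrightarrow> 0"
      if "\<And>z. cmod z < 1 \<Longrightarrow> (\<lambda>n. F n z) \<longlonglongrightarrow> 0" "z \<in> space ?N" for F z
    proof -
      have "z \<in> ball 0 1" using that(2) by (simp add: space_restrict_space)
      then have "\<phi> z \<in> ball 0 1" using \<phi>(2) by blast
      then have "cmod (\<phi> z) < 1" by simp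
      then have "(\<lambda>n. h z * F n (\<phi> z)) \<longlonglongrightarrow> h z * 0" by (intro tendsto_intros that(1))
      then show ?thesis by (simp add: weighted_comp_def)
    qed
  qed (use assms in \<open>auto simp: weighted_comp_def algebra_simps\<close>)
qed

lemma test_function_eq: "test_function \<alpha> h \<phi> w = weighted_comp h \<phi> (bergman_kernel \<alpha> w)"
  by (simp add: test_function_def weighted_comp_def bergman_kernel_def fun_eq_iff)

theorem proposition3p1:
  fixes \<alpha> :: real and \<phi> h :: "complex \<Rightarrow> complex"
  assumes "\<alpha> > -1"
    and "\<phi> holomorphic_on ball 0 1" and "\<phi> ` ball 0 1 \<subseteq> ball 0 1"
    and "h \<in> bergman_space \<alpha>"
  shows
    "(bounded_operator (bergman_space \<alpha>) (bergman_norm \<alpha>) (bergman_space \<alpha>) (bergman_norm \<alpha>)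
        (weighted_comp h \<phi>)
      \<longleftrightarrow> bergman_Carleson \<alpha> (pullback_measure \<alpha> h \<phi>)) \<and>
     (bergman_Carleson \<alpha> (pullback_measure \<alpha> h \<phi>)
      \<longleftrightarrow> bdd_above ((\<lambda>w. bergman_norm \<alpha> (test_function \<alpha> h \<phi> w)) ` ball 0 1)) \<and>
     (compact_operator (bergman_space \<alpha>) (bergman_norm \<alpha>) (bergman_space \<alpha>) (bergman_norm \<alpha>)
        (weighted_comp h \<phi>)
      \<longleftrightarrow> vanishing_bergman_Carleson \<alpha> (pullback_measure \<alpha> h \<phi>)) \<and>
     (compact_operator (bergman_space \<alpha>) (bergman_norm \<alpha>) (bergman_space \<alpha>) (bergman_norm \<alpha>)
        (weighted_comp h \<phi>)
      \<longleftrightarrow> ((\<lambda>w. bergman_norm \<alpha> (test_function \<alpha> h \<phi> w)) \<longlongrightarrow> 0)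
            (filtercomap cmod (at_left 1)))"
proof -
  define \<mu> where "\<mu> = pullback_measure \<alpha> h \<phi>"
  interpret J: bergman_embedding \<alpha> 1 \<mu> \<mu> "L2_space \<mu>" "L2_norm \<mu>" "\<lambda>f. f"
    unfolding \<mu>_def by (rule embedding_Carleson[OF assms])
  interpret W: bergman_embedding \<alpha> pi \<mu>
    "density (restrict_space lborel (ball 0 1)) (\<lambda>z. ennreal (bergman_weight \<alpha> z))"
    "bergman_space \<alpha>" "bergman_norm \<alpha>" "weighted_comp h \<phi>"
    unfolding \<mu>_def by (rule embedding_weighted_comp[OF assms])
  let ?t = "\<lambda>w. bergman_norm \<alpha> (test_function \<alpha> h \<phi> w)"
  \<comment> \<open>Finiteness of the kernel integral places the test function in the space, where
    \<open>bergman_norm\<close> is a genuine norm and not the default value of a divergent integral.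
    \<open>J\<close> and \<open>W\<close> are over the same \<open>\<mu>\<close>, so this describes
    the kernel integral of both.\<close>
  have K: "W.K w = ennreal (pi * (?t w)\<^sup>2)" if w: "cmod w < 1" for w
  proof -
    let ?k = "bergman_kernel \<alpha> w"
    have k: "?k \<in> bergman_space \<alpha>" using assms(1) w by (rule bergman_kernel_in_space)
    have "(\<integral>\<^sup>+z. ennreal ((cmod (?k z))\<^sup>2) \<partial>\<mu>) = W.K w" by (simp add: J.K_eq[OF w])
    also have "\<dots> < \<infinity>" by (rule W.K_finite[OF w])
    finally show ?thesis
      unfolding W.K_eq[OF w] test_function_eq by (intro W.Y_norm W.T_in[OF k])
  qed
  have bdd: "(\<exists>M. \<forall>u. cmod u < 1 \<longrightarrow> W.K u \<le> ennreal M) \<longleftrightarrow> bdd_above (?t ` ball 0 1)"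
  proof
    assume "\<exists>M. \<forall>u. cmod u < 1 \<longrightarrow> W.K u \<le> ennreal M"
    then obtain M where M: "\<And>u. cmod u < 1 \<Longrightarrow> W.K u \<le> ennreal M" by blast
    have "?t u \<le> sqrt (\<bar>M\<bar> / pi)" if "cmod u < 1" for u
    proof (rule real_le_rsqrt)
      have "ennreal (pi * (?t u)\<^sup>2) \<le> ennreal \<bar>M\<bar>"
        using M[OF that] unfolding K[OF that] by (rule order_trans) (auto intro: ennreal_leI)
      then have "pi * (?t u)\<^sup>2 \<le> \<bar>M\<bar>" by (subst (asm) ennreal_le_iff) auto
      then show "(?t u)\<^sup>2 \<le> \<bar>M\<bar> / pi" by (simp add: field_simps)
    qed
    then show "bdd_above (?t ` ball 0 1)" by (intro bdd_aboveI2[where M = "sqrt (\<bar>M\<bar> / pi)"]) auto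
  next
    assume "bdd_above (?t ` ball 0 1)"
    then obtain b where b: "\<And>u. cmod u < 1 \<Longrightarrow> ?t u \<le> b"
      unfolding bdd_above_def by (metis image_eqI mem_ball_0)
    have "W.K u \<le> ennreal (pi * b\<^sup>2)" if "cmod u < 1" for u
      unfolding K[OF that] by (intro ennreal_leI mult_left_mono power_mono b that bergman_norm_nonneg) auto
    then show "\<exists>M. \<forall>u. cmod u < 1 \<longrightarrow> W.K u \<le> ennreal M" by blast
  qed
  have van: "(\<forall>e>0. \<exists>\<rho><1. \<forall>u. \<rho> < cmod u \<and> cmod u < 1 \<longrightarrow> W.K u \<le> ennreal e) \<longleftrightarrow>
    (?t \<longlongrightarrow> 0) (filtercomap cmod (at_left 1))"
  proof -
    \<comment> \<open>Brings the limit as \<open>|w|\<close> increases to 1 into the form used in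
      \<open>compact_iff\<close>.\<close>
    have ev: "eventually P (filtercomap cmod (at_left 1)) \<longleftrightarrow> (\<exists>\<rho><1. \<forall>u. \<rho> < cmod u \<and> cmod u < 1 \<longrightarrow> P u)" for P
    proof
      assume "eventually P (filtercomap cmod (at_left 1))"
      then obtain Q where Q: "eventually Q (at_left (1::real))" "\<And>u. Q (cmod u) \<Longrightarrow> P u"
        by (auto simp: eventually_filtercomap)
      then show "\<exists>\<rho><1. \<forall>u. \<rho> < cmod u \<and> cmod u < 1 \<longrightarrow> P u"
        unfolding eventually_at_left_field by blast
    next
      assume "\<exists>\<rho><1. \<forall>u. \<rho> < cmod u \<and> cmod u < 1 \<longrightarrow> P u"
      then obtain \<rho> where \<rho>: "\<rho> < 1" "\<And>u. \<rho> < cmod u \<Longrightarrow> cmod u < 1 \<Longrightarrow> P u" by blast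
      have "eventually (\<lambda>x. \<rho> < x \<and> x < 1) (at_left (1::real))"
        unfolding eventually_at_left_field using \<rho>(1) by blast
      with \<rho>(2) show "eventually P (filtercomap cmod (at_left 1))"
        unfolding eventually_filtercomap by blast
    qed
    show ?thesis
    proof
      assume L: "\<forall>e>0. \<exists>\<rho><1. \<forall>u. \<rho> < cmod u \<and> cmod u < 1 \<longrightarrow> W.K u \<le> ennreal e"
      show "(?t \<longlongrightarrow> 0) (filtercomap cmod (at_left 1))"
      proof (rule tendstoI)
        fix e :: real assume "e > 0"
        then obtain \<rho> where \<rho>: "\<rho> < 1" "\<And>u. \<rho> < cmod u \<Longrightarrow> cmod u < 1 \<Longrightarrow> W.K u \<le> ennreal (e\<^sup>2)"
          using L[rule_format, of "e\<^sup>2"] by auto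
        have "dist (?t u) 0 < e" if "\<rho> < cmod u" "cmod u < 1" for u
        proof -
          have "pi * (?t u)\<^sup>2 \<le> e\<^sup>2"
            using \<rho>(2)[OF that] unfolding K[OF that(2)] by (subst (asm) ennreal_le_iff) auto
          \<comment> \<open>Since \<pi> > 1, the bound \<open>e^2\<close> on the kernel integral
            leaves room for a strict inequality.\<close>
          also have "\<dots> < pi * e\<^sup>2" using \<open>e > 0\<close> pi_gt3 by simp
          finally have "?t u < e" using \<open>e > 0\<close> by (simp add: power2_less_imp_less)
          then show ?thesis using bergman_norm_nonneg by simp
        qed
        with \<rho>(1) show "\<forall>\<^sub>F u in filtercomap cmod (at_left 1). dist (?t u) 0 < e"
          unfolding ev by blast
      qed
    next
      assume L: "(?t \<longlongrightarrow> 0) (filtercomap cmod (at_left 1))"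
      show "\<forall>e>0. \<exists>\<rho><1. \<forall>u. \<rho> < cmod u \<and> cmod u < 1 \<longrightarrow> W.K u \<le> ennreal e"
      proof (intro allI impI)
        fix e :: real assume "e > 0"
        then have "\<forall>\<^sub>F u in filtercomap cmod (at_left 1). dist (?t u) 0 < sqrt (e / pi)"
          using L by (intro tendstoD) auto
        then obtain \<rho> where \<rho>: "\<rho> < 1" "\<And>u. \<rho> < cmod u \<Longrightarrow> cmod u < 1 \<Longrightarrow> dist (?t u) 0 < sqrt (e / pi)"
          unfolding ev by blast
        have "W.K u \<le> ennreal e" if "\<rho> < cmod u" "cmod u < 1" for u
        proof -
          have "?t u \<le> sqrt (e / pi)" using \<rho>(2)[OF that] bergman_norm_nonneg[of \<alpha>] by simp
          then have "(?t u)\<^sup>2 \<le> (sqrt (e / pi))\<^sup>2" by (intro power_mono bergman_norm_nonneg)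
          then have "pi * (?t u)\<^sup>2 \<le> e" using \<open>e > 0\<close> by (simp add: field_simps)
          then show ?thesis unfolding K[OF that(2)] by (rule ennreal_leI)
        qed
        with \<rho>(1) show "\<exists>\<rho><1. \<forall>u. \<rho> < cmod u \<and> cmod u < 1 \<longrightarrow> W.K u \<le> ennreal e" by blast
      qed
    qed
  qed
  show ?thesis
    unfolding bergman_Carleson_def vanishing_bergman_Carleson_def \<mu>_def[symmetric]
      W.bounded_iff J.bounded_iff W.compact_iff J.compact_iff bdd van by simp
qed

end
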